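(* Let $0<\delta<\tfrac12$ and set $\rho=\tfrac12-\sqrt{\delta(1-\delta)}$. Then for every integer $w\ge 3$, \[ R_w(\delta)\le H(\rho)-\frac1w\log_2\!\left(1+\left(\frac{\rho}{1-\rho}\right)^w\right). \] Moreover, \[ R_3(\delta)\le\begin{cases}\tfrac23, & \delta\le \tfrac12-\tfrac{\sqrt3}{4},\\[4pt] \tfrac23 H_4(3\rho), & \delta>\tfrac12-\tfrac{\sqrt3}{4},\end{cases} \] and \[ R_4(\delta)\le H(\rho)+\tfrac14\log_2 F(\rho), \] where $H_4(x)=x\log_4 3-x\log_4 x-(1-x)\log_4(1-x)$ and $F(\rho)=(1-\rho)^4+4\rho(1-\rho)^3+6\rho^2(1-\rho)^2$.
   Context: $H(x)=-x\log_2x-(1-x)\log_2(1-x)$ is the binary entropy function. A linear code $C\le\mathbb{F}_2^n$ has parity-check density at most $w$ if its dual code $C^\perp$ is spanned by vectors of Hamming weight at most $w$. For $0<\delta<1/2$, $R_w(\delta)$ denotes the largest asymptotically achievable rate of binary linear codes with parity-check density at most $w$ and relative minimum distance at least $\delta$, i.e. $R_w(\delta)=\limsup_{n\to\infty}\max_C\frac1n\log_2|C|$, where the maximum is over linear codes $C\le\mathbb{F}_2^n$ of parity-check density at most $w$ and minimum Hamming distance at least $\delta n$. *)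

theory Defs
  imports "HOL-Analysis.Analysis" "HOL-Library.Liminf_Limsup"
begin

definition bin_entropy :: "real \<Rightarrow> real" where
  "bin_entropy x = - x * log 2 x - (1 - x) * log 2 (1 - x)"

definition H4 :: "real \<Rightarrow> real" where
  "H4 x = x * log 4 3 - x * log 4 x - (1 - x) * log 4 (1 - x)"

definition Fpoly :: "real \<Rightarrow> real" where
  "Fpoly r = (1 - r)^4 + 4 * r * (1 - r)^3 + 6 * r^2 * (1 - r)^2"

text \<open>Vectors of F_2^n are boolean lists of length n (True = 1).\<close>
definition vecs :: "nat \<Rightarrow> bool list set" where
  "vecs n = {x. length x = n}"

definition vadd :: "bool list \<Rightarrow> bool list \<Rightarrow> bool list" where
  "vadd x y = map2 (\<lambda>a b. a \<noteq> b) x y"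

definition hweight :: "bool list \<Rightarrow> nat" where
  "hweight x = length (filter id x)"

definition hdist :: "bool list \<Rightarrow> bool list \<Rightarrow> nat" where
  "hdist x y = hweight (vadd x y)"

definition orth :: "bool list \<Rightarrow> bool list \<Rightarrow> bool" where
  "orth x y = even (length (filter id (map2 (\<and>) x y)))"

text \<open>A linear code: an F_2-subspace of F_2^n (over F_2, closure under addition and
  containing 0 is exactly being a subspace).\<close>
definition linear_code :: "nat \<Rightarrow> bool list set \<Rightarrow> bool" where
  "linear_code n C \<longleftrightarrow> C \<subseteq> vecs n \<and> replicate n False \<in> C \<and>
     (\<forall>x\<in>C. \<forall>y\<in>C. vadd x y \<in> C)"

definition dual_code :: "nat \<Rightarrow> bool list set \<Rightarrow> bool list set" where
  "dual_code n C = {y \<in> vecs n. \<forall>x\<in>C. orth x y}"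

definition span2 :: "nat \<Rightarrow> bool list set \<Rightarrow> bool list set" where
  "span2 n S = \<Inter>{D. linear_code n D \<and> S \<subseteq> D}"

definition pc_density_le :: "nat \<Rightarrow> nat \<Rightarrow> bool list set \<Rightarrow> bool" where
  "pc_density_le n w C \<longleftrightarrow>
     (\<exists>S. S \<subseteq> vecs n \<and> (\<forall>s\<in>S. hweight s \<le> w) \<and> dual_code n C = span2 n S)"

definition min_dist_ge :: "real \<Rightarrow> bool list set \<Rightarrow> bool" where
  "min_dist_ge d C \<longleftrightarrow> (\<forall>x\<in>C. \<forall>y\<in>C. x \<noteq> y \<longrightarrow> real (hdist x y) \<ge> d)"

text \<open>Best rate at length n (the admissible set always contains the zero code).\<close>
definition best_rate :: "nat \<Rightarrow> real \<Rightarrow> nat \<Rightarrow> ereal" where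
  "best_rate w \<delta> n = (SUP C \<in> {C. linear_code n C \<and> pc_density_le n w C \<and>
                                 min_dist_ge (\<delta> * real n) C}.
                        ereal (log 2 (real (card C)) / real n))"

definition R_rate :: "nat \<Rightarrow> real \<Rightarrow> ereal" where
  "R_rate w \<delta> = limsup (best_rate w \<delta>)"

end

theory Submission
  imports Defs
begin

text \<open>
  Let \<open>Q\<close> be the quotient of the cube by the dual code, with the Hamming weight of a coset the minimal
  weight of its elements; it has as many elements as the code. The eigenvalues of the Cayley graph
  that the cube induces on \<open>Q\<close> are \<open>n - 2 |c|\<close> for codewords \<open>c\<close>, so all but the largest are at most
  \<open>n (1 - 2 \<delta>)\<close>. Pushing forward a radial function supported just inside radius \<open>\<rho>' n\<close> with
  \<open>\<rho>' > \<rho>\<close> gives a Rayleigh quotient above that value, and Cauchy-Schwarz on its support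
  bounds the size of \<open>Q\<close> by a constant times that of the ball of radius \<open>\<rho>' n\<close> in \<open>Q\<close>.

  Light parity checks make this ball small. For \<open>0 < x \<le> 1\<close> let \<open>Z\<close> be the sum of \<open>x ^ weight\<close> over \<open>Q\<close>.
  Adjoin coordinates check by check: a check with \<open>t\<close> new coordinates identifies the sum of
  these with an element of weight at most \<open>w - t\<close>, which multiplies the partial sum by at most \<open>b ^ t\<close>,
  for a suitable \<open>b\<close> depending on \<open>w\<close> and \<open>x\<close>. Hence \<open>Z \<le> b ^ n\<close>, the ball of radius \<open>r\<close> has at most
  \<open>b ^ n / x ^ r\<close> elements, and the rate is at most \<open>log b - \<rho> log x\<close>.
\<close>

subsection \<open>Binary characters and syndromes\<close>

lemma card_sym_diff:
  assumes "finite A" "finite B"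
  shows "card (sym_diff A B) + 2 * card (A \<inter> B) = card A + card B"
proof -
  have "card (sym_diff A B) = card (A - B) + card (B - A)"
    using assms by (intro card_Un_disjoint) auto
  moreover have "card A = card (A - B) + card (A \<inter> B)"
    using assms by (metis card_Int_Diff add.commute)
  moreover have "card B = card (B - A) + card (A \<inter> B)"
    using assms by (metis card_Int_Diff add.commute Int_commute)
  ultimately show ?thesis by simp
qed

lemma sum_Pow_card:
  fixes f :: "nat \<Rightarrow> real"
  assumes "finite T"
  shows "(\<Sum>A\<in>Pow T. f (card A)) = (\<Sum>k\<le>card T. real (card T choose k) * f k)"
proof -
  have "(\<Sum>A\<in>Pow T. f (card A)) = (\<Sum>k\<le>card T. \<Sum>A | A \<in> Pow T \<and> card A = k. f (card A))"
    by (rule sum.group[symmetric]) (use assms card_mono in auto)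
  also have "\<dots> = (\<Sum>k\<le>card T. real (card T choose k) * f k)"
    using assms by (intro sum.cong) (auto simp: n_subsets)
  finally show ?thesis .
qed

text \<open>Vectors over F_2 are represented by their supports: symmetric difference is addition and
  the parity of an intersection is the inner product. \<open>chi c\<close> is then the additive
  character attached to \<open>c\<close>.\<close>

definition chi :: "'a set \<Rightarrow> 'a set \<Rightarrow> real" where
  "chi c A = (-1) ^ card (c \<inter> A)"

text \<open>The syndrome map; symmetric difference is the addition of syndromes as well as of vectors.\<close>
definition syn :: "'a set set \<Rightarrow> 'a set \<Rightarrow> 'a set set" where
  "syn CC A = {c \<in> CC. odd (card (c \<inter> A))}"

definition set_code :: "'a set \<Rightarrow> 'a set set \<Rightarrow> bool" where
  "set_code N CC \<longleftrightarrow> CC \<subseteq> Pow N \<and> {} \<in> CC \<and> (\<forall>c\<in>CC. \<forall>d\<in>CC. sym_diff c d \<in> CC)"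

lemma even_card_Int_sym_diff:
  assumes "finite A" "finite B"
  shows "even (card (c \<inter> sym_diff A B)) \<longleftrightarrow> (even (card (c \<inter> A)) \<longleftrightarrow> even (card (c \<inter> B)))"
proof -
  have "c \<inter> sym_diff A B = sym_diff (c \<inter> A) (c \<inter> B)" by auto
  then have "card (c \<inter> sym_diff A B) + 2 * card ((c \<inter> A) \<inter> (c \<inter> B)) = card (c \<inter> A) + card (c \<inter> B)"
    using card_sym_diff[of "c \<inter> A" "c \<inter> B"] assms by auto
  then show ?thesis by presburger
qed

lemma chi_commute: "chi c A = chi A c"
  by (simp add: chi_def Int_commute)

lemma chi_eq: "chi c A = (if even (card (c \<inter> A)) then 1 else - 1)"
  by (simp add: chi_def)

lemma chi_sym_diff:
  assumes "finite A" "finite B"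
  shows "chi c (sym_diff A B) = chi c A * chi c B"
  unfolding chi_eq using even_card_Int_sym_diff[OF assms, of c] by auto

lemma syn_sym_diff:
  assumes "finite A" "finite B"
  shows "syn CC (sym_diff A B) = sym_diff (syn CC A) (syn CC B)"
  unfolding syn_def using even_card_Int_sym_diff[OF assms] by blast

text \<open>Orthogonality of characters: if some \<open>d\<close> in the code meets \<open>u\<close>
  in an odd number of points, translating the summation by \<open>d\<close> reverses every
  sign.\<close>

lemma sum_chi_set_code:
  assumes "finite N" "set_code N CC" "u \<subseteq> N"
  shows "(\<Sum>c\<in>CC. chi c u) = (if syn CC u = {} then real (card CC) else 0)"
proof (cases "syn CC u = {}")
  case True
  then have "chi c u = 1" if "c \<in> CC" for c using that by (auto simp: syn_def chi_eq)
  then show ?thesis using True by simp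
next
  case False
  then obtain d where d: "d \<in> CC" "odd (card (d \<inter> u))" by (auto simp: syn_def)
  have fin: "finite c" if "c \<in> CC" for c
    using that assms by (auto simp: set_code_def intro: finite_subset)
  have "(\<Sum>c\<in>CC. chi c u) = (\<Sum>c\<in>CC. chi (sym_diff c d) u)"
    by (rule sum.reindex_bij_witness[of _ "\<lambda>c. sym_diff c d" "\<lambda>c. sym_diff c d"])
       (use d assms(2) in \<open>auto simp: set_code_def intro!: arg_cong2[of _ _ _ _ chi]\<close>)
  also have "\<dots> = (\<Sum>c\<in>CC. - chi c u)"
  proof (rule sum.cong)
    fix c assume c: "c \<in> CC"
    have "chi (sym_diff c d) u = chi c u * chi d u"
      using chi_sym_diff[OF fin[OF c] fin[OF d(1)], of u] by (simp add: chi_commute)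
    then show "chi (sym_diff c d) u = - chi c u" using d(2) by (simp add: chi_eq[of d u])
  qed simp
  finally show ?thesis using False by (simp add: sum_negf)
qed

text \<open>This is where a code equals its double dual, by a character sum over all of \<open>Pow N\<close>.\<close>
lemma dual_word_through_coordinate:
  assumes "finite N" "set_code N CC" "i \<in> N" "{i} \<notin> CC"
  obtains y where "y \<subseteq> N" "syn CC y = {}" "i \<in> y"
proof (rule ccontr)
  assume "\<not> thesis"
  with that have no: "i \<notin> y" if "y \<subseteq> N" "syn CC y = {}" for y using that by blast
  have fin: "finite CC" "\<And>c. c \<in> CC \<Longrightarrow> finite c" "\<And>c. c \<in> CC \<Longrightarrow> c \<subseteq> N"
    using assms(1,2) by (auto simp: set_code_def intro: finite_subset)
  have PowN: "set_code N (Pow N)" by (auto simp: set_code_def)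
  \<comment> \<open>Two evaluations of one double sum. Over \<open>y\<close> first it vanishes, as
    \<open>c\<close> plus \<open>{i}\<close> is never zero; over \<open>c\<close> first it is
    supported on dual words, where \<open>chi {i} y\<close> is 1 by \<open>no\<close>, and the word
    \<open>{}\<close> makes it positive.\<close>
  have "(\<Sum>y\<in>Pow N. \<Sum>c\<in>CC. chi c y * chi {i} y) = (\<Sum>c\<in>CC. \<Sum>y\<in>Pow N. chi y (sym_diff c {i}))"
    using fin by (subst sum.swap) (intro sum.cong refl, simp add: chi_sym_diff chi_commute)
  also have "\<dots> = 0"
  proof (rule sum.neutral, rule ballI)
    fix c assume c: "c \<in> CC"
    define u where "u = sym_diff c {i}"
    have uN: "u \<subseteq> N" using fin(3)[OF c] assms(3) by (auto simp: u_def)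
    have "c \<noteq> {i}" using c assms(4) by auto
    then have "u \<noteq> {}" by (auto simp: u_def)
    then obtain k where k: "k \<in> u" by auto
    then have "{k} \<in> syn (Pow N) u" using uN by (auto simp: syn_def)
    then show "(\<Sum>y\<in>Pow N. chi y (sym_diff c {i})) = 0"
      using sum_chi_set_code[OF assms(1) PowN uN] by (auto simp: u_def)
  qed
  finally have z: "(\<Sum>y\<in>Pow N. chi {i} y * (\<Sum>c\<in>CC. chi c y)) = 0"
    by (simp add: sum_distrib_left mult.commute)
  have "chi {i} y * (\<Sum>c\<in>CC. chi c y) = (if syn CC y = {} then real (card CC) else 0)"
    if "y \<in> Pow N" for y
    using that no[of y] sum_chi_set_code[OF assms(1,2), of y] by (auto simp: chi_eq)
  with z have "(\<Sum>y\<in>Pow N. if syn CC y = {} then real (card CC) else 0) = 0" by simp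
  then have "\<forall>y\<in>Pow N. (if syn CC y = {} then real (card CC) else 0) = 0"
    using assms(1) by (subst (asm) sum_nonneg_eq_0_iff) auto
  moreover have "syn CC {} = {}" by (simp add: syn_def)
  ultimately have "card CC = 0" by (metis Pow_bottom of_nat_eq_0_iff)
  then show False using fin(1) assms(2) by (auto simp: set_code_def)
qed

text \<open>Parseval on the quotient by the dual code: summing \<open>chi c A * chi c B\<close> over
  codewords leaves only pairs with equal syndromes, so the transforms on \<open>CC\<close> see
  \<open>f\<close> and \<open>g\<close> only through their coset sums.\<close>

lemma parseval_set_code:
  fixes f g :: "'a set \<Rightarrow> real"
  assumes "finite N" "set_code N CC"
  shows "(\<Sum>c\<in>CC. (\<Sum>A\<in>Pow N. f A * chi c A) * (\<Sum>B\<in>Pow N. g B * chi c B)) =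
    real (card CC) * (\<Sum>A\<in>Pow N. \<Sum>B\<in>Pow N. if syn CC A = syn CC B then f A * g B else 0)"
proof -
  have fin: "finite A" if "A \<in> Pow N" for A using that assms(1) by (auto intro: finite_subset)
  have "(\<Sum>c\<in>CC. (\<Sum>A\<in>Pow N. f A * chi c A) * (\<Sum>B\<in>Pow N. g B * chi c B)) =
    (\<Sum>c\<in>CC. \<Sum>A\<in>Pow N. \<Sum>B\<in>Pow N. f A * g B * (chi c A * chi c B))"
    by (simp add: sum_product mult_ac)
  also have "\<dots> = (\<Sum>A\<in>Pow N. \<Sum>c\<in>CC. \<Sum>B\<in>Pow N. f A * g B * (chi c A * chi c B))"
    by (rule sum.swap)
  also have "\<dots> = (\<Sum>A\<in>Pow N. \<Sum>B\<in>Pow N. \<Sum>c\<in>CC. f A * g B * (chi c A * chi c B))"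
    by (intro sum.cong refl sum.swap)
  also have "\<dots> = (\<Sum>A\<in>Pow N. \<Sum>B\<in>Pow N. f A * g B * (\<Sum>c\<in>CC. chi c A * chi c B))"
    by (simp add: sum_distrib_left)
  also have "\<dots> = (\<Sum>A\<in>Pow N. \<Sum>B\<in>Pow N. real (card CC) * (if syn CC A = syn CC B then f A * g B else 0))"
  proof (intro sum.cong refl)
    fix A B assume A: "A \<in> Pow N" and B: "B \<in> Pow N"
    have "(\<Sum>c\<in>CC. chi c A * chi c B) = (\<Sum>c\<in>CC. chi c (sym_diff A B))"
      using chi_sym_diff[OF fin[OF A] fin[OF B]] by simp
    also have "\<dots> = (if sym_diff (syn CC A) (syn CC B) = {} then real (card CC) else 0)"
    proof -
      have "sym_diff A B \<subseteq> N" using A B by blast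
      from sum_chi_set_code[OF assms this] show ?thesis
        unfolding syn_sym_diff[OF fin[OF A] fin[OF B]] .
    qed
    also have "\<dots> = (if syn CC A = syn CC B then real (card CC) else 0)" by auto
    finally show "f A * g B * (\<Sum>c\<in>CC. chi c A * chi c B) =
        real (card CC) * (if syn CC A = syn CC B then f A * g B else 0)" by simp
  qed
  finally show ?thesis by (simp add: sum_distrib_left)
qed

text \<open>Characters diagonalise the adjacency operator of the cube: flipping coordinate
  \<open>i\<close> multiplies \<open>chi c\<close> by \<open>chi c {i}\<close>, which is -1 exactly
  for \<open>i\<close> in \<open>c\<close>.\<close>

lemma chi_transform_adjacency:
  fixes g :: "'a set \<Rightarrow> real"
  assumes "finite N" "c \<subseteq> N"
  shows "(\<Sum>A\<in>Pow N. (\<Sum>i\<in>N. g (sym_diff A {i})) * chi c A)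
    = (real (card N) - 2 * real (card c)) * (\<Sum>A\<in>Pow N. g A * chi c A)"
proof -
  have fin: "finite A" if "A \<in> Pow N" for A using that assms(1) by (auto intro: finite_subset)
  have "(\<Sum>A\<in>Pow N. (\<Sum>i\<in>N. g (sym_diff A {i})) * chi c A)
      = (\<Sum>i\<in>N. \<Sum>A\<in>Pow N. g (sym_diff A {i}) * chi c A)"
    by (subst sum.swap) (simp add: sum_distrib_right)
  also have "\<dots> = (\<Sum>i\<in>N. chi c {i} * (\<Sum>A\<in>Pow N. g A * chi c A))"
  proof (intro sum.cong refl)
    fix i assume i: "i \<in> N"
    have "(\<Sum>A\<in>Pow N. g (sym_diff A {i}) * chi c A) = (\<Sum>A\<in>Pow N. g A * chi c (sym_diff A {i}))"
      by (rule sum.reindex_bij_witness[of _ "\<lambda>A. sym_diff A {i}" "\<lambda>A. sym_diff A {i}"])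
         (use i in \<open>auto intro!: arg_cong2[of _ _ _ _ chi] simp del: Un_insert_right\<close>)
    also have "\<dots> = (\<Sum>A\<in>Pow N. chi c {i} * (g A * chi c A))"
      using fin by (intro sum.cong refl) (simp add: chi_sym_diff)
    finally show "(\<Sum>A\<in>Pow N. g (sym_diff A {i}) * chi c A) = chi c {i} * (\<Sum>A\<in>Pow N. g A * chi c A)"
      by (simp add: sum_distrib_left)
  qed
  also have "\<dots> = (\<Sum>i\<in>N. chi c {i}) * (\<Sum>A\<in>Pow N. g A * chi c A)"
    by (simp add: sum_distrib_right)
  also have "(\<Sum>i\<in>N. chi c {i}) = (\<Sum>i\<in>N. 1 - 2 * of_bool (i \<in> c))"
    by (intro sum.cong) (auto simp: chi_def)
  also have "\<dots> = real (card N) - 2 * real (card c)"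
    using assms by (simp add: sum_subtractf flip: sum_distrib_left)
       (simp add: of_bool_def sum.If_cases Int_absorb1 Int_def[symmetric] inf.absorb2 Collect_mem_eq)
  finally show ?thesis .
qed

subsection \<open>The spectral bound\<close>

text \<open>A Rayleigh quotient argument on the Cayley graph of the quotient. \<open>\<mu>\<close>
  bounds the quotient of the push-forward of \<open>g\<close> from below, \<open>\<nu>\<close>
  bounds every eigenvalue but that of the empty codeword, and Cauchy-Schwarz limits the constant
  component of a function carried by few cosets.\<close>

lemma set_code_card_le_support:
  fixes g :: "'a set \<Rightarrow> real"
  assumes N: "finite N" "set_code N CC"
    and g0: "\<And>A. A \<subseteq> N \<Longrightarrow> 0 \<le> g A"
    and gpos: "A0 \<subseteq> N" "0 < g A0"
    and adj: "\<And>A. A \<subseteq> N \<Longrightarrow> \<mu> * g A \<le> (\<Sum>i\<in>N. g (sym_diff A {i}))"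
    and dist: "\<And>c. c \<in> CC \<Longrightarrow> c \<noteq> {} \<Longrightarrow> real (card N) - 2 * real (card c) \<le> \<nu>"
    and lam: "\<nu> < \<mu>" "\<nu> \<le> real (card N)"
    and supp: "\<And>A. A \<subseteq> N \<Longrightarrow> g A \<noteq> 0 \<Longrightarrow> A \<in> S" and S: "S \<subseteq> Pow N"
  shows "(\<mu> - \<nu>) * real (card CC) \<le> (real (card N) - \<nu>) * real (card (syn CC ` S))"
proof -
  define ghat where "ghat c = (\<Sum>A\<in>Pow N. g A * chi c A)" for c
  \<comment> \<open>\<open>F\<close> is the push-forward of \<open>g\<close> to syndromes and
    \<open>P\<close> is its squared norm, as \<open>P_F\<close> shows.\<close>
  define F where "F q = (\<Sum>A | A \<in> Pow N \<and> syn CC A = q. g A)" for q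
  define P where "P = (\<Sum>A\<in>Pow N. \<Sum>B\<in>Pow N. if syn CC A = syn CC B then g A * g B else 0)"
  define n where "n = real (card N)"
  have fin: "finite CC" "{} \<in> CC" "\<And>c. c \<in> CC \<Longrightarrow> c \<subseteq> N"
    using N by (auto simp: set_code_def intro: finite_subset)
  have P: "(\<Sum>c\<in>CC. ghat c ^ 2) = real (card CC) * P"
    using parseval_set_code[OF N, of g g] by (simp add: ghat_def P_def power2_eq_square)
  have ghat0: "ghat {} = (\<Sum>A\<in>Pow N. g A)" by (simp add: ghat_def chi_def)
  \<comment> \<open>By \<open>adj\<close>, \<open>\<mu>\<close> times the squared norm is at most
    the quadratic form of the adjacency operator. The form is then diagonalised, and every term but
    that of \<open>{}\<close> is bounded with \<open>\<nu>\<close>.\<close>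
  have "\<mu> * (real (card CC) * P) = real (card CC) *
      (\<Sum>A\<in>Pow N. \<Sum>B\<in>Pow N. if syn CC A = syn CC B then g A * (\<mu> * g B) else 0)"
    unfolding P_def sum_distrib_left by (intro sum.cong refl) auto
  also have "\<dots> \<le> real (card CC) * (\<Sum>A\<in>Pow N. \<Sum>B\<in>Pow N. if syn CC A = syn CC B
      then g A * (\<Sum>i\<in>N. g (sym_diff B {i})) else 0)"
    by (intro mult_left_mono sum_mono) (use g0 adj in \<open>auto intro!: mult_left_mono\<close>)
  also have "\<dots> = (\<Sum>c\<in>CC. ghat c * ((n - 2 * real (card c)) * ghat c))"
    unfolding parseval_set_code[OF N, symmetric] ghat_def n_def
    by (intro sum.cong refl) (use fin chi_transform_adjacency[OF N(1)] in auto)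
  also have "\<dots> = (\<Sum>c\<in>CC. (n - 2 * real (card c)) * ghat c ^ 2)"
    by (simp add: power2_eq_square mult_ac)
  also have "\<dots> = n * ghat {} ^ 2 + (\<Sum>c\<in>CC - {{}}. (n - 2 * real (card c)) * ghat c ^ 2)"
    using fin by (subst sum.remove[of CC "{}"]) auto
  also have "\<dots> \<le> n * ghat {} ^ 2 + (\<Sum>c\<in>CC - {{}}. \<nu> * ghat c ^ 2)"
    using dist by (intro add_left_mono sum_mono mult_right_mono) (auto simp: n_def)
  also have "\<dots> = n * ghat {} ^ 2 + (\<nu> * (\<Sum>c\<in>CC. ghat c ^ 2) - \<nu> * ghat {} ^ 2)"
    using fin by (subst sum.remove[of CC "{}"]) (auto simp: sum_distrib_left algebra_simps)
  finally have 1: "(\<mu> - \<nu>) * real (card CC) * P \<le> (n - \<nu>) * ghat {} ^ 2"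
    unfolding P by (simp add: algebra_simps)
  have finP: "finite (Pow N)" using N by simp
  have P_F: "P = (\<Sum>q\<in>syn CC ` Pow N. F q ^ 2)"
  proof -
    have "P = (\<Sum>A\<in>Pow N. g A * F (syn CC A))"
      unfolding P_def F_def
    proof (intro sum.cong refl)
      fix A
      have "(\<Sum>B\<in>Pow N. if syn CC A = syn CC B then g A * g B else 0)
          = (\<Sum>B | B \<in> Pow N \<and> syn CC A = syn CC B. g A * g B)"
        using finP by (subst sum.inter_filter) auto
      then show "(\<Sum>B\<in>Pow N. if syn CC A = syn CC B then g A * g B else 0) =
         g A * sum g {Aa \<in> Pow N. syn CC Aa = syn CC A}"
        by (simp add: sum_distrib_left eq_commute)
    qed
    also have "\<dots> = (\<Sum>q\<in>syn CC ` Pow N. \<Sum>A | A \<in> Pow N \<and> syn CC A = q. g A * F (syn CC A))"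
      by (rule sum.image_gen) (use finP in auto)
    also have "\<dots> = (\<Sum>q\<in>syn CC ` Pow N. F q ^ 2)"
      by (intro sum.cong refl) (simp add: F_def power2_eq_square sum_distrib_right)
    finally show ?thesis .
  qed
  have "ghat {} = (\<Sum>q\<in>syn CC ` Pow N. F q)"
    unfolding ghat0 F_def by (rule sum.image_gen) (use finP in auto)
  also have "\<dots> = (\<Sum>q\<in>syn CC ` S. F q)"
  proof (rule sum.mono_neutral_right)
    show "\<forall>q\<in>syn CC ` Pow N - syn CC ` S. F q = 0"
      unfolding F_def by (intro ballI sum.neutral) (use supp in auto)
  qed (use finP S in auto)
  finally have "ghat {} ^ 2 = (\<Sum>q\<in>syn CC ` S. 1 * F q) ^ 2" by simp
  also have "\<dots> \<le> (\<Sum>q\<in>syn CC ` S. 1\<^sup>2) * (\<Sum>q\<in>syn CC ` S. F q ^ 2)"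
    by (rule Cauchy_Schwarz_ineq_sum)
  also have "\<dots> \<le> real (card (syn CC ` S)) * P"
    unfolding P_F using finP S by (auto intro!: mult_left_mono sum_mono2)
  finally have 2: "ghat {} ^ 2 \<le> real (card (syn CC ` S)) * P" .
  have "0 < ghat {}"
    unfolding ghat0 using gpos g0 finP by (intro sum_pos2[of _ A0]) auto
  then have "0 < real (card (syn CC ` S)) * P" using 2 by (smt (verit) zero_less_power)
  then have Ppos: "0 < P" by (simp add: zero_less_mult_iff)
  have "(\<mu> - \<nu>) * real (card CC) * P \<le> (n - \<nu>) * (real (card (syn CC ` S)) * P)"
    using 1 mult_left_mono[OF 2, of "n - \<nu>"] lam by (simp add: n_def)
  then show ?thesis using Ppos by (simp add: n_def flip: mult.assoc)
qed

section \<open>Radial test functions on the cube\<close>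

lemma sum_flip_radial:
  fixes \<gamma> :: "nat \<Rightarrow> real"
  assumes "finite N" "A \<subseteq> N"
  shows "(\<Sum>i\<in>N. \<gamma> (card (sym_diff A {i}))) =
    real (card A) * \<gamma> (card A - 1) + (real (card N) - real (card A)) * \<gamma> (card A + 1)"
proof -
  have fin: "finite A" using assms finite_subset by auto
  have "(\<Sum>i\<in>N. \<gamma> (card (sym_diff A {i}))) =
      (\<Sum>i\<in>N - A. \<gamma> (card (sym_diff A {i}))) + (\<Sum>i\<in>A. \<gamma> (card (sym_diff A {i})))"
    using assms by (rule sum.subset_diff[rotated])
  also have "(\<Sum>i\<in>A. \<gamma> (card (sym_diff A {i}))) = (\<Sum>i\<in>A. \<gamma> (card A - 1))"
  proof (intro sum.cong refl)
    fix i assume "i \<in> A"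
    then have "sym_diff A {i} = A - {i}" by auto
    then show "\<gamma> (card (sym_diff A {i})) = \<gamma> (card A - 1)" using fin \<open>i \<in> A\<close> by simp
  qed
  also have "(\<Sum>i\<in>N - A. \<gamma> (card (sym_diff A {i}))) = (\<Sum>i\<in>N - A. \<gamma> (card A + 1))"
  proof (intro sum.cong refl)
    fix i assume "i \<in> N - A"
    then have "sym_diff A {i} = insert i A" by auto
    then show "\<gamma> (card (sym_diff A {i})) = \<gamma> (card A + 1)" using fin \<open>i \<in> N - A\<close> by simp
  qed
  finally show ?thesis using assms fin by (simp add: card_Diff_subset of_nat_diff card_mono)
qed

definition tent :: "nat \<Rightarrow> nat \<Rightarrow> nat \<Rightarrow> real" where
  "tent c h k = max 0 (real h - \<bar>real k - real c\<bar>)"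

lemma tent_nonneg: "0 \<le> tent c h k"
  by (simp add: tent_def)

text \<open>Away from \<open>c\<close> the tent is locally the maximum of 0 and an affine function,
  hence convex. Only at the peak is there a loss, from \<open>h\<close> to
  \<open>h - 1\<close>.\<close>

lemma tent_adjacent:
  assumes "1 \<le> h" "1 \<le> k"
  shows "2 * (1 - 1 / real h) * tent c h k \<le> tent c h (k - 1) + tent c h (k + 1)"
proof -
  have h: "0 \<le> 1 / real h" "1 / real h \<le> 1" using assms by auto
  consider "k = c" | "k < c" | "c < k" by linarith
  then show ?thesis
  proof cases
    case 1
    then have eqs: "tent c h k = real h" "tent c h (k - 1) = real h - 1" "tent c h (k + 1) = real h - 1"
      using assms by (auto simp: tent_def of_nat_diff)
    show ?thesis unfolding eqs using assms by (simp add: field_simps)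
  next
    case 2
    have "2 * (1 - 1 / real h) * tent c h k \<le> 2 * 1 * tent c h k"
      using h by (intro mult_right_mono tent_nonneg) auto
    also have "\<dots> \<le> tent c h (k - 1) + tent c h (k + 1)"
      using 2 assms by (auto simp: tent_def of_nat_diff max_def)
    finally show ?thesis .
  next
    case 3
    have "2 * (1 - 1 / real h) * tent c h k \<le> 2 * 1 * tent c h k"
      using h by (intro mult_right_mono tent_nonneg) auto
    also have "\<dots> \<le> tent c h (k - 1) + tent c h (k + 1)"
      using 3 assms by (auto simp: tent_def of_nat_diff max_def)
    finally show ?thesis .
  qed
qed

text \<open>On the support of the tent the tilt \<open>y\<close> balances the two neighbour counts, both becoming at
  least \<open>sqrt (L * M)\<close>; the tent then loses only the factor \<open>1 - 1 / h\<close>, at its peak.\<close>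
lemma tilted_tent_adjacency:
  fixes n c h k :: nat and L M y :: real
  assumes "1 \<le> h" "h < c" "c + h < n" "k \<le> n"
  defines "L \<equiv> real c - real h" and "M \<equiv> real n - real c - real h" and "y \<equiv> sqrt (L / M)"
  shows "2 * (1 - 1 / real h) * sqrt (L * M) * (y ^ k * tent c h k) \<le>
    real k * (y ^ (k - 1) * tent c h (k - 1)) + (real n - real k) * (y ^ (k + 1) * tent c h (k + 1))"
proof (cases "tent c h k = 0")
  case True
  have "0 \<le> y" using assms by (simp add: L_def M_def)
  then show ?thesis using True assms(4) by (simp add: tent_nonneg)
next
  case False
  have LM: "0 < L" "0 < M" using assms by (auto simp: L_def M_def)
  have y: "0 < y" using LM by (simp add: y_def)
  have k: "L \<le> real k" "M \<le> real n - real k"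
    using False unfolding L_def M_def tent_def max_def by (auto split: if_splits)
  have k1: "1 \<le> k" using k(1) LM by (cases k) auto
  \<comment> \<open>Hence \<open>sqrt (L * M) * y ^ k\<close> equals both
    \<open>L * y ^ (k - 1)\<close> and \<open>M * y ^ (k + 1)\<close>.\<close>
  have s1: "sqrt (L * M) = M * y" "sqrt (L * M) * y = L"
    using LM by (auto simp: y_def real_sqrt_mult real_sqrt_divide field_simps)
  have yk: "y ^ k = y * y ^ (k - 1)" using k1 by (cases k) auto
  have "2 * (1 - 1 / real h) * sqrt (L * M) * (y ^ k * tent c h k)
      = sqrt (L * M) * y ^ k * (2 * (1 - 1 / real h) * tent c h k)" by simp
  also have "\<dots> \<le> sqrt (L * M) * y ^ k * (tent c h (k - 1) + tent c h (k + 1))"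
    using LM y assms(1) k1 by (intro mult_left_mono tent_adjacent) auto
  also have "\<dots> = (sqrt (L * M) * y) * (y ^ (k - 1) * tent c h (k - 1)) + sqrt (L * M) * y ^ k * tent c h (k + 1)"
    unfolding yk by (simp add: algebra_simps)
  also have "\<dots> = L * (y ^ (k - 1) * tent c h (k - 1)) + M * (y ^ (k + 1) * tent c h (k + 1))"
    unfolding s1(2) by (simp add: s1(1))
  also have "\<dots> \<le> real k * (y ^ (k - 1) * tent c h (k - 1)) + (real n - real k) * (y ^ (k + 1) * tent c h (k + 1))"
    using k y by (intro add_mono mult_right_mono) (auto simp: tent_nonneg)
  finally show ?thesis .
qed

text \<open>The test function is the tilted tent centred at weight \<open>c\<close>. It vanishes on
  weights beyond \<open>c + h\<close>, and the minimum distance gives the eigenvalue bound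
  \<open>real n - 2 * d\<close>.\<close>

lemma set_code_card_le_ball:
  assumes N: "finite N" "set_code N CC" "card N = n"
    and dist: "\<And>A. A \<in> CC \<Longrightarrow> A \<noteq> {} \<Longrightarrow> d \<le> real (card A)" "0 \<le> d"
    and h: "1 \<le> h" "h < c" "c + h < n"
    and \<mu>: "\<mu> = 2 * (1 - 1 / real h) * sqrt ((real c - real h) * (real n - real c - real h))"
      "real n - 2 * d < \<mu>"
  shows "(\<mu> - (real n - 2 * d)) * real (card CC) \<le> 2 * d * real (card (syn CC ` {A. A \<subseteq> N \<and> card A \<le> c + h}))"
proof -
  define y where "y = sqrt ((real c - real h) / (real n - real c - real h))"
  define g :: "'a set \<Rightarrow> real" where "g A = y ^ card A * tent c h (card A)" for A
  have y: "0 < y" using h by (simp add: y_def)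
  obtain A0 where A0: "A0 \<subseteq> N" "card A0 = c"
    using obtain_subset_with_card_n[of c N] N h by auto
  have "(\<mu> - (real n - 2 * d)) * real (card CC) \<le>
      (real (card N) - (real n - 2 * d)) * real (card (syn CC ` {A. A \<subseteq> N \<and> card A \<le> c + h}))"
  proof (rule set_code_card_le_support[OF N(1,2), where g = g and ?A0.0 = A0])
    show "0 \<le> g A" for A using y by (simp add: g_def tent_nonneg)
    show "0 < g A0" using y A0 h by (simp add: g_def tent_def)
    show "\<mu> * g A \<le> (\<Sum>i\<in>N. g (sym_diff A {i}))" if "A \<subseteq> N" for A
      using tilted_tent_adjacency[OF h, of "card A"] sum_flip_radial[OF N(1) that, of "\<lambda>k. y ^ k * tent c h k"]
        card_mono[OF N(1) that] unfolding g_def \<mu>(1) N(3) y_def by simp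
    show "real (card N) - 2 * real (card A) \<le> real n - 2 * d" if "A \<in> CC" "A \<noteq> {}" for A
      using dist(1)[OF that] N(3) by simp
    show "A \<in> {A. A \<subseteq> N \<and> card A \<le> c + h}" if "A \<subseteq> N" "g A \<noteq> 0" for A
      using that by (auto simp: g_def tent_def max_def split: if_splits)
  qed (use A0 \<mu> N dist in auto)
  then show ?thesis using N by simp
qed

subsection \<open>Growth of balls of cosets\<close>

text \<open>\<open>x ^ m\<close> with \<open>m\<close> the least weight of a vector supported on \<open>U\<close> with syndrome \<open>q\<close>,
  and \<open>0\<close> if there is none.\<close>
definition leader_wt :: "'a set set \<Rightarrow> real \<Rightarrow> 'a set \<Rightarrow> 'a set set \<Rightarrow> real" where
  "leader_wt CC x U q = Max (insert 0 ((\<lambda>A. x ^ card A) ` {A. A \<subseteq> U \<and> syn CC A = q}))"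

lemma leader_wt_cases:
  assumes "finite U"
  obtains "leader_wt CC x U q = 0"
    | A where "A \<subseteq> U" "syn CC A = q" "leader_wt CC x U q = x ^ card A"
proof -
  have "finite {A. A \<subseteq> U \<and> syn CC A = q}" using assms by (auto intro: finite_subset[of _ "Pow U"])
  then have "leader_wt CC x U q \<in> insert 0 ((\<lambda>A. x ^ card A) ` {A. A \<subseteq> U \<and> syn CC A = q})"
    unfolding leader_wt_def by (intro Max_in) auto
  then show ?thesis using that by auto
qed

lemma leader_wt_nonneg: "finite U \<Longrightarrow> 0 \<le> leader_wt CC x U q"
  unfolding leader_wt_def by (intro Max_ge) (auto intro: finite_subset[of _ "Pow U"])

lemma leader_wt_ge: "finite U \<Longrightarrow> A \<subseteq> U \<Longrightarrow> x ^ card A \<le> leader_wt CC x U (syn CC A)"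
  unfolding leader_wt_def by (intro Max_ge) (auto intro: finite_subset[of _ "Pow U"])

text \<open>Start of the induction: without coordinates only the zero syndrome is reached, by the
  zero vector.\<close>

lemma leader_wt_empty: "(\<Sum>q\<in>syn CC ` Pow N. leader_wt CC x {} q) = 1" if "finite N"
proof -
  have [simp]: "syn CC {} = {}" by (simp add: syn_def)
  have "leader_wt CC x {} q = (if q = {} then 1 else 0)" for q
  proof (cases "q = {}")
    case True
    then have "{A. A \<subseteq> {} \<and> syn CC A = q} = {{}}" by auto
    then show ?thesis using True by (simp add: leader_wt_def)
  next
    case False
    then have *: "{A. A \<subseteq> {} \<and> syn CC A = q} = {}" by auto
    show ?thesis using False unfolding leader_wt_def * by simp
  qed
  moreover have "{} \<in> syn CC ` Pow N" by (rule image_eqI[of _ _ "{}"]) auto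
  ultimately show ?thesis using that by simp
qed

text \<open>Adding \<open>R\<close> to a vector raises its weight by at most \<open>card R\<close>.
  This supplies the two comparisons of \<open>u\<close> and \<open>v\<close> in
  \<open>growth_factor\<close>.\<close>

lemma leader_wt_translate:
  assumes "finite U" "R \<subseteq> U" "0 \<le> x" "x \<le> 1"
  shows "x ^ card R * leader_wt CC x U q \<le> leader_wt CC x U (sym_diff q (syn CC R))"
  using leader_wt_cases[OF assms(1), of CC x q]
proof cases
  case 1
  then show ?thesis using leader_wt_nonneg[OF assms(1)] by simp
next
  case (2 A)
  have fin: "finite A" "finite R" using assms 2 by (auto intro: finite_subset)
  have "card (sym_diff A R) \<le> card R + card A" using card_sym_diff[OF fin] by simp
  then have "x ^ card R * leader_wt CC x U q \<le> x ^ card (sym_diff A R)"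
    using assms 2 by (simp add: power_add[symmetric] power_decreasing)
  also have "\<dots> \<le> leader_wt CC x U (syn CC (sym_diff A R))"
    using assms 2 by (intro leader_wt_ge) auto
  finally show ?thesis using syn_sym_diff[OF fin, of CC] 2 by simp
qed

text \<open>A leader supported on \<open>U \<union> T\<close> splits into its parts in
  \<open>T\<close> and in \<open>U\<close>; the first is \<open>A\<close>, the second competes for
  the value on \<open>U\<close>.\<close>

lemma leader_wt_Un_le:
  assumes "finite U" "finite T" "U \<inter> T = {}" "0 \<le> x"
  obtains A where "A \<subseteq> T" "leader_wt CC x (U \<union> T) q \<le> x ^ card A * leader_wt CC x U (sym_diff q (syn CC A))"
  using leader_wt_cases[OF finite_UnI[OF assms(1,2)], of CC x q]
proof cases
  case 1
  then show ?thesis using leader_wt_nonneg[OF assms(1)] assms(4) that[of "{}"] by simp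
next
  case (2 A)
  have fin: "finite A" using assms 2 by (auto intro: finite_subset)
  have "A = sym_diff (A \<inter> U) (A \<inter> T)" using assms 2 by auto
  then have "syn CC A = sym_diff (syn CC (A \<inter> U)) (syn CC (A \<inter> T))"
    using syn_sym_diff[of "A \<inter> U" "A \<inter> T" CC] fin by auto
  then have q: "sym_diff q (syn CC (A \<inter> T)) = syn CC (A \<inter> U)" using 2 by auto
  have "A = (A \<inter> T) \<union> (A \<inter> U)" using assms 2 by auto
  then have "card A = card (A \<inter> T) + card (A \<inter> U)"
    using card_Un_disjoint[of "A \<inter> T" "A \<inter> U"] fin assms by auto
  then have "leader_wt CC x (U \<union> T) q = x ^ card (A \<inter> T) * x ^ card (A \<inter> U)"
    using 2 by (simp add: power_add)
  also have "\<dots> \<le> x ^ card (A \<inter> T) * leader_wt CC x U (syn CC (A \<inter> U))"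
    using assms by (intro mult_left_mono leader_wt_ge) auto
  finally show ?thesis using that[of "A \<inter> T"] q by simp
qed

text \<open>A check has \<open>t\<close> new coordinates and \<open>j\<close> old ones, with syndrome sum \<open>g\<close> of the latter;
  \<open>u\<close> and \<open>v\<close> are the values of \<open>leader_wt\<close> at \<open>q\<close> and \<open>q + g\<close>.\<close>
definition growth_factor :: "nat \<Rightarrow> real \<Rightarrow> real \<Rightarrow> bool" where
  "growth_factor w x b \<longleftrightarrow> (\<forall>t j. \<forall>u v::real. 1 \<le> t \<longrightarrow> t + j \<le> w \<longrightarrow> 0 \<le> u \<longrightarrow> 0 \<le> v \<longrightarrow>
     x ^ j * u \<le> v \<longrightarrow> x ^ j * v \<le> u \<longrightarrow>
     (\<Sum>k\<le>t. real (t choose k) * max (x ^ k * u) (x ^ (t - k) * v)) \<le> b ^ t * (u + v))"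

lemma sum_syn_translate:
  assumes "finite N" "A \<subseteq> N"
  shows "(\<Sum>q\<in>syn CC ` Pow N. h (sym_diff q (syn CC A))) = (\<Sum>q\<in>syn CC ` Pow N. h q)"
proof -
  have *: "sym_diff q (syn CC A) \<in> syn CC ` Pow N" if q: "q \<in> syn CC ` Pow N" for q
  proof -
    obtain B where B: "B \<subseteq> N" "q = syn CC B" using q by auto
    then have "sym_diff q (syn CC A) = syn CC (sym_diff B A)"
      using assms finite_subset by (metis syn_sym_diff)
    then show ?thesis using B assms by blast
  qed
  show ?thesis
    by (rule sum.reindex_bij_witness[of _ "\<lambda>q. sym_diff q (syn CC A)" "\<lambda>q. sym_diff q (syn CC A)"])
       (use * in blast)+
qed

text \<open>As \<open>s\<close> has syndrome zero, its new part \<open>T\<close> and old part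
  \<open>R\<close> have equal syndromes, so using \<open>A\<close> or its complement in
  \<open>T\<close> leads to old syndromes that differ by that of \<open>R\<close>. Bounding such
  pairs together by a maximum is where the check saves.\<close>

lemma sum_leader_wt_step:
  assumes N: "finite N" and s: "s \<subseteq> N" "syn CC s = {}" "card s \<le> w" "s - U \<noteq> {}"
    and U: "U \<subseteq> N" and x: "0 \<le> x" "x \<le> 1" and gf: "growth_factor w x b"
  shows "(\<Sum>q\<in>syn CC ` Pow N. leader_wt CC x (U \<union> s) q)
    \<le> b ^ card (s - U) * (\<Sum>q\<in>syn CC ` Pow N. leader_wt CC x U q)"
proof -
  define T R t where "T = s - U" and "R = s \<inter> U" and "t = card T"
  let ?G = "syn CC ` Pow N" and ?\<phi> = "leader_wt CC x U"
  have fin: "finite U" "finite T" "finite R" "finite s" and TN: "T \<subseteq> N"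
    using N U s by (auto simp: T_def R_def intro: finite_subset)
  have UT: "U \<union> s = U \<union> T" "U \<inter> T = {}" by (auto simp: T_def)
  have "s = sym_diff T R" by (auto simp: T_def R_def)
  then have TR: "syn CC T = syn CC R" using syn_sym_diff[OF fin(2,3), of CC] s(2) by auto
  have tR: "t + card R \<le> w"
    using s(3) card_Int_Diff[OF fin(4), of U] by (simp add: t_def T_def R_def)
  have t1: "1 \<le> t" using s(4) fin by (simp add: t_def T_def Suc_le_eq card_gt_0_iff)
  define m where "m A q = max (x ^ card A * ?\<phi> q) (x ^ (t - card A) * ?\<phi> (sym_diff q (syn CC T)))"
    for A :: "'a set" and q
  \<comment> \<open>A subset \<open>A\<close> of \<open>T\<close> attaining the maximum and its complement contribute the same term.\<close>
  have half: "2 * leader_wt CC x (U \<union> T) q \<le> (\<Sum>A\<in>Pow T. m A (sym_diff q (syn CC A)))" for q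
  proof -
    obtain A where A: "A \<subseteq> T" and le: "leader_wt CC x (U \<union> T) q \<le> x ^ card A * ?\<phi> (sym_diff q (syn CC A))"
      using leader_wt_Un_le[OF fin(1,2) UT(2) x(1)] by blast
    have finA: "finite A" using A fin finite_subset by auto
    have A': "T - A = sym_diff A T" using A by auto
    have eq: "sym_diff (sym_diff q (syn CC (T - A))) (syn CC T) = sym_diff q (syn CC A)"
      using syn_sym_diff[OF finA fin(2), of CC, folded A'] by blast
    have cardA: "t - card (T - A) = card A"
      using A fin finA by (simp add: t_def card_Diff_subset card_mono)
    have "T \<noteq> {}" using t1 by (auto simp: t_def)
    then have neq: "A \<noteq> T - A" using A by blast
    have "2 * leader_wt CC x (U \<union> T) q \<le> m A (sym_diff q (syn CC A)) + m (T - A) (sym_diff q (syn CC (T - A)))"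
      using le unfolding m_def cardA eq by auto
    also have "\<dots> = (\<Sum>A\<in>{A, T - A}. m A (sym_diff q (syn CC A)))"
      using neq by simp
    also have "\<dots> \<le> (\<Sum>A\<in>Pow T. m A (sym_diff q (syn CC A)))"
      using A fin x leader_wt_nonneg[OF fin(1)]
      by (intro sum_mono2) (auto simp: m_def le_max_iff_disj)
    finally show ?thesis .
  qed
  have bnd: "(\<Sum>A\<in>Pow T. m A q) \<le> b ^ t * (?\<phi> q + ?\<phi> (sym_diff q (syn CC T)))" for q
  proof -
    have "(\<Sum>A\<in>Pow T. m A q) = (\<Sum>k\<le>t. real (t choose k) *
        max (x ^ k * ?\<phi> q) (x ^ (t - k) * ?\<phi> (sym_diff q (syn CC T))))"
      unfolding m_def t_def
      using sum_Pow_card[OF fin(2), of "\<lambda>k. max (x ^ k * ?\<phi> q) (x ^ (card T - k) * ?\<phi> (sym_diff q (syn CC T)))"] .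
    also have "\<dots> \<le> b ^ t * (?\<phi> q + ?\<phi> (sym_diff q (syn CC T)))"
    proof -
      \<comment> \<open>Here \<open>j\<close> is \<open>card R\<close>: shifting by the syndrome of
        \<open>T\<close> amounts to adding \<open>R\<close>, which lies in \<open>U\<close>.\<close>
      have 1: "x ^ card R * ?\<phi> q \<le> ?\<phi> (sym_diff q (syn CC T))"
        unfolding TR by (rule leader_wt_translate) (use fin x R_def in auto)
      have "x ^ card R * ?\<phi> (sym_diff q (syn CC T)) \<le> ?\<phi> (sym_diff (sym_diff q (syn CC T)) (syn CC R))"
        by (rule leader_wt_translate) (use fin x R_def in auto)
      also have "sym_diff (sym_diff q (syn CC T)) (syn CC R) = q" unfolding TR by blast
      finally show ?thesis using gf[unfolded growth_factor_def] t1 tR 1 leader_wt_nonneg[OF fin(1)] by blast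
    qed
    finally show ?thesis .
  qed
  \<comment> \<open>The 2 from \<open>half\<close> cancels at the end, because \<open>bnd\<close>
    sums two translates of the same function.\<close>
  have "2 * (\<Sum>q\<in>?G. leader_wt CC x (U \<union> s) q) \<le> (\<Sum>q\<in>?G. \<Sum>A\<in>Pow T. m A (sym_diff q (syn CC A)))"
    unfolding UT sum_distrib_left by (intro sum_mono half)
  also have "\<dots> = (\<Sum>A\<in>Pow T. \<Sum>q\<in>?G. m A (sym_diff q (syn CC A)))" by (rule sum.swap)
  also have "\<dots> = (\<Sum>A\<in>Pow T. \<Sum>q\<in>?G. m A q)"
    using TN by (intro sum.cong refl sum_syn_translate N) auto
  also have "\<dots> = (\<Sum>q\<in>?G. \<Sum>A\<in>Pow T. m A q)" by (rule sum.swap)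
  also have "\<dots> \<le> (\<Sum>q\<in>?G. b ^ t * (?\<phi> q + ?\<phi> (sym_diff q (syn CC T))))"
    by (intro sum_mono bnd)
  also have "\<dots> = b ^ t * ((\<Sum>q\<in>?G. ?\<phi> q) + (\<Sum>q\<in>?G. ?\<phi> (sym_diff q (syn CC T))))"
    by (simp add: sum.distrib flip: sum_distrib_left)
  also have "\<dots> = 2 * (b ^ t * (\<Sum>q\<in>?G. ?\<phi> q))"
    unfolding sum_syn_translate[OF N TN] by simp
  finally show ?thesis by (simp add: t_def T_def)
qed

text \<open>Induction on the number of coordinates outside \<open>U\<close>: a check through a
  missing coordinate adds at least that one, and the exponents of \<open>b\<close> add up to
  \<open>card N\<close>.\<close>

lemma sum_leader_wt_le:
  assumes N: "finite N" and cover: "\<And>i. i \<in> N \<Longrightarrow> \<exists>s. i \<in> s \<and> s \<subseteq> N \<and> syn CC s = {} \<and> card s \<le> w"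
    and x: "0 \<le> x" "x \<le> 1" and gf: "growth_factor w x b" "0 \<le> b"
  shows "(\<Sum>q\<in>syn CC ` Pow N. leader_wt CC x N q) \<le> b ^ card N"
proof -
  let ?Z = "\<lambda>U. \<Sum>q\<in>syn CC ` Pow N. leader_wt CC x U q"
  have "?Z N \<le> b ^ card (N - U) * ?Z U" if "U \<subseteq> N" for U
    using that
  proof (induction "card (N - U)" arbitrary: U rule: less_induct)
    case less
    show ?case
    proof (cases "U = N")
      case False
      then obtain i where i: "i \<in> N" "i \<notin> U" using less.prems by auto
      then obtain s where s: "i \<in> s" "s \<subseteq> N" "syn CC s = {}" "card s \<le> w" using cover by blast
      have card: "card (N - U) = card (N - (U \<union> s)) + card (s - U)"
      proof -
        have "N - U = (N - (U \<union> s)) \<union> (s - U)" using s by auto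
        moreover have "finite (N - (U \<union> s))" "finite (s - U)"
          using N s by (auto intro: finite_subset)
        moreover have "(N - (U \<union> s)) \<inter> (s - U) = {}" by auto
        ultimately show ?thesis by (metis card_Un_disjoint)
      qed
      have ne: "s - U \<noteq> {}" using s i by auto
      then have pos: "0 < card (s - U)" using s N by (simp add: card_gt_0_iff finite_subset)
      have "?Z N \<le> b ^ card (N - (U \<union> s)) * ?Z (U \<union> s)"
        by (rule less.hyps) (use card pos less.prems s in auto)
      also have "\<dots> \<le> b ^ card (N - (U \<union> s)) * (b ^ card (s - U) * ?Z U)"
        using gf by (intro mult_left_mono sum_leader_wt_step[OF N s(2,3,4) ne less.prems x]) auto
      finally show ?thesis by (simp add: card power_add mult.assoc)
    qed simp
  qed
  from this[of "{}"] show ?thesis using leader_wt_empty[OF N, of CC x] by simp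
qed

text \<open>A Markov type estimate: every syndrome of the ball contributes at least
  \<open>x ^ r\<close> to the sum of leader weights.\<close>

lemma card_syn_ball_le:
  assumes N: "finite N" and cover: "\<And>i. i \<in> N \<Longrightarrow> \<exists>s. i \<in> s \<and> s \<subseteq> N \<and> syn CC s = {} \<and> card s \<le> w"
    and x: "0 < x" "x \<le> 1" and gf: "growth_factor w x b" "0 \<le> b"
  shows "x ^ r * real (card (syn CC ` {A. A \<subseteq> N \<and> card A \<le> r})) \<le> b ^ card N"
proof -
  let ?B = "syn CC ` {A. A \<subseteq> N \<and> card A \<le> r}"
  have "x ^ r * real (card ?B) = (\<Sum>q\<in>?B. x ^ r)" by simp
  also have "\<dots> \<le> (\<Sum>q\<in>?B. leader_wt CC x N q)"
  proof (rule sum_mono)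
    fix q assume "q \<in> ?B"
    then obtain A where A: "A \<subseteq> N" "card A \<le> r" "q = syn CC A" by auto
    have "x ^ r \<le> x ^ card A" using A x by (intro power_decreasing) auto
    then show "x ^ r \<le> leader_wt CC x N q" using leader_wt_ge[OF N A(1), of x CC] A by simp
  qed
  also have "\<dots> \<le> (\<Sum>q\<in>syn CC ` Pow N. leader_wt CC x N q)"
    using N by (intro sum_mono2) (auto simp: leader_wt_nonneg)
  also have "\<dots> \<le> b ^ card N"
    by (rule sum_leader_wt_le[OF N cover]) (use x gf in auto)
  finally show ?thesis .
qed

section \<open>Asymptotics in the length\<close>

text \<open>For \<open>\<rho>' > \<rho>\<close> the spectral gap is linear in \<open>n\<close>, and
  so is the factor \<open>2 * d\<close> in the spectral bound. Their quotient gives a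
  \<open>K\<close> independent of \<open>n\<close> and of the code.\<close>

lemma eventually_set_code_card_le:
  fixes \<delta> \<rho> \<rho>' x b :: real
  assumes \<delta>: "0 < \<delta>" "\<delta> < 1/2" and \<rho>: "\<rho> = 1/2 - sqrt (\<delta> * (1 - \<delta>))" "\<rho> < \<rho>'" "\<rho>' < 1/2"
    and x: "0 < x" "x \<le> 1" and gf: "growth_factor w x b" "0 \<le> b"
  obtains K where "0 < K" "eventually (\<lambda>n. \<forall>CC. set_code {..<n} CC \<longrightarrow>
      (\<forall>A\<in>CC. A \<noteq> {} \<longrightarrow> \<delta> * real n \<le> real (card A)) \<longrightarrow>
      (\<forall>i<n. \<exists>s. i \<in> s \<and> s \<subseteq> {..<n} \<and> syn CC s = {} \<and> card s \<le> w) \<longrightarrow>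
      real (card CC) \<le> K * x powr (- \<rho>' * real n) * b ^ n) sequentially"
proof -
  define \<nu> where "\<nu> = 1 - 2 * \<delta>"
  have sq: "\<delta> * (1 - \<delta>) < (1/2)\<^sup>2"
  proof -
    have "0 < (1/2 - \<delta>)\<^sup>2" using \<delta> by simp
    then show ?thesis by (simp add: power2_eq_square algebra_simps)
  qed
  then have "sqrt (\<delta> * (1 - \<delta>)) < 1/2" by (intro real_less_lsqrt) auto
  then have \<rho>0: "0 < \<rho>" using \<rho> by simp
  \<comment> \<open>\<open>\<rho>\<close> is the smaller root of
    \<open>2 * sqrt (r * (1 - r)) = 1 - 2 * \<delta>\<close>.\<close>
  have "(2 * sqrt (\<rho> * (1 - \<rho>)))\<^sup>2 = \<nu>\<^sup>2"
  proof -
    have "\<rho> * (1 - \<rho>) = 1/4 - (sqrt (\<delta> * (1 - \<delta>)))\<^sup>2"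
      unfolding \<rho>(1) by (simp add: power2_eq_square algebra_simps del: real_sqrt_mult_self real_sqrt_abs2)
    also have "\<dots> = 1/4 - \<delta> * (1 - \<delta>)" using \<delta> by simp
    finally have "\<rho> * (1 - \<rho>) = 1/4 - \<delta> * (1 - \<delta>)" .
    moreover have "(sqrt (\<rho> * (1 - \<rho>)))\<^sup>2 = \<rho> * (1 - \<rho>)" using \<rho>0 \<rho> by simp
    ultimately show ?thesis unfolding power_mult_distrib \<nu>_def
      by (simp only:) (simp add: power2_eq_square algebra_simps)
  qed
  then have \<nu>_eq: "\<nu> = 2 * sqrt (\<rho> * (1 - \<rho>))"
    using \<delta> \<rho>0 \<rho> by (subst (asm) power2_eq_iff_nonneg) (auto simp: \<nu>_def)
  have "\<rho> * (1 - \<rho>) < \<rho>' * (1 - \<rho>')"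
  proof -
    have "0 < (\<rho>' - \<rho>) * (1 - \<rho> - \<rho>')" using \<rho> by (intro mult_pos_pos) auto
    then show ?thesis by (simp add: algebra_simps)
  qed
  then have gap: "\<nu> < 2 * (1 - 0) * sqrt (\<rho>' * (1 - \<rho>'))" using \<nu>_eq by simp
  \<comment> \<open>\<open>h\<close> is fixed first, so large that the factor
    \<open>1 - 1 / h\<close> does not use up the gap.\<close>
  have "(\<lambda>h. 2 * (1 - 1 / real h) * sqrt (\<rho>' * (1 - \<rho>'))) \<longlonglongrightarrow> 2 * (1 - 0) * sqrt (\<rho>' * (1 - \<rho>'))"
    by (intro tendsto_intros lim_const_over_n)
  from order_tendstoD(1)[OF this gap] have "eventually (\<lambda>h. \<nu> < 2 * (1 - 1 / real h) * sqrt (\<rho>' * (1 - \<rho>'))) sequentially" .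
  then have "eventually (\<lambda>h. \<nu> < 2 * (1 - 1 / real h) * sqrt (\<rho>' * (1 - \<rho>')) \<and> 1 \<le> h) sequentially"
    using eventually_ge_at_top[of "1::nat"] by eventually_elim simp
  then obtain h :: nat where h: "\<nu> < 2 * (1 - 1 / real h) * sqrt (\<rho>' * (1 - \<rho>'))" "1 \<le> h"
    using eventually_happens'[OF sequentially_bot] by blast
  \<comment> \<open>Half of the gap is kept; the other half absorbs the rounding of \<open>c\<close>
    as \<open>n\<close> grows.\<close>
  define \<eta> where "\<eta> = (2 * (1 - 1 / real h) * sqrt (\<rho>' * (1 - \<rho>')) - \<nu>) / 2"
  have \<eta>: "0 < \<eta>" "\<nu> + \<eta> < 2 * (1 - 1 / real h) * sqrt ((\<rho>' - 0) * (1 - \<rho>'))"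
  proof -
    have "0 < (r - s) / 2 \<and> s + (r - s) / 2 < r" if "s < r" for r s :: real
      using that by (simp add: field_simps)
    from this[OF h(1)] show "0 < \<eta>" "\<nu> + \<eta> < 2 * (1 - 1 / real h) * sqrt ((\<rho>' - 0) * (1 - \<rho>'))"
      unfolding \<eta>_def diff_zero by blast+
  qed
  have "(\<lambda>n. 2 * (1 - 1 / real h) * sqrt ((\<rho>' - (2 * real h + 1) / real n) * (1 - \<rho>'))) \<longlonglongrightarrow>
      2 * (1 - 1 / real h) * sqrt ((\<rho>' - 0) * (1 - \<rho>'))"
    by (intro tendsto_intros lim_const_over_n)
  from order_tendstoD(1)[OF this \<eta>(2)]
  have ev1: "eventually (\<lambda>n. \<nu> + \<eta> < 2 * (1 - 1 / real h) * sqrt ((\<rho>' - (2 * real h + 1) / real n) * (1 - \<rho>'))) sequentially" .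
  have ev2: "eventually (\<lambda>n. (2 * real h + 1) / \<rho>' < real n) sequentially"
    using filterlim_real_sequentially by (simp add: filterlim_at_top_dense)
  show ?thesis
  proof (rule that[of "2 * \<delta> / \<eta>"])
    show "0 < 2 * \<delta> / \<eta>" using \<delta> \<eta> by simp
    show "eventually (\<lambda>n. \<forall>CC. set_code {..<n} CC \<longrightarrow>
      (\<forall>A\<in>CC. A \<noteq> {} \<longrightarrow> \<delta> * real n \<le> real (card A)) \<longrightarrow>
      (\<forall>i<n. \<exists>s. i \<in> s \<and> s \<subseteq> {..<n} \<and> syn CC s = {} \<and> card s \<le> w) \<longrightarrow>
      real (card CC) \<le> 2 * \<delta> / \<eta> * x powr (- \<rho>' * real n) * b ^ n) sequentially"
      using ev1 ev2
    proof eventually_elim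
      case (elim n)
      show ?case
      proof (intro allI impI)
        fix CC assume CC: "set_code {..<n} CC" "\<forall>A\<in>CC. A \<noteq> {} \<longrightarrow> \<delta> * real n \<le> real (card A)"
          "\<forall>i<n. \<exists>s. i \<in> s \<and> s \<subseteq> {..<n} \<and> syn CC s = {} \<and> card s \<le> w"
        have \<rho>'0: "0 < \<rho>'" using \<rho>0 \<rho> by simp
        have n1: "2 * real h + 1 < \<rho>' * real n" using elim(2) \<rho>'0 by (simp add: field_simps)
        then have n: "2 * real h + 1 < \<rho>' * real n" "0 < real n" by (cases n; simp)+
        \<comment> \<open>The radius \<open>c + h\<close> is the floor of
          \<open>\<rho>' * real n\<close>, so \<open>c - h\<close> is at least
          \<open>\<rho>' * real n - 2 * h - 1\<close>; hence the correction term in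
          \<open>ev1\<close>.\<close>
        define c where "c = nat \<lfloor>\<rho>' * real n\<rfloor> - h"
        have "2 * int h + 1 \<le> \<lfloor>\<rho>' * real n\<rfloor>" using n by (simp add: le_floor_iff)
        then have c_eq: "real c = of_int \<lfloor>\<rho>' * real n\<rfloor> - real h" by (simp add: c_def of_nat_diff)
        have c1: "real c + real h \<le> \<rho>' * real n" unfolding c_eq by simp
        have c2: "\<rho>' * real n - 2 * real h - 1 \<le> real c - real h" unfolding c_eq by linarith
        have "\<rho>' * real n < 1 * real n" using n \<rho> by (intro mult_strict_right_mono) auto
        then have hc: "h < c" "c + h < n" using c1 c2 n by linarith+
        define \<mu> where "\<mu> = 2 * (1 - 1 / real h) * sqrt ((real c - real h) * (real n - real c - real h))"
        have "(\<nu> + \<eta>) * real n \<le> 2 * (1 - 1 / real h) * sqrt ((\<rho>' - (2 * real h + 1) / real n) * (1 - \<rho>')) * real n"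
          using elim(1) n by (intro mult_right_mono) auto
        also have "\<dots> = 2 * (1 - 1 / real h) * (sqrt ((\<rho>' - (2 * real h + 1) / real n) * (1 - \<rho>')) * sqrt ((real n)\<^sup>2))"
          using n by simp
        also have "\<dots> = 2 * (1 - 1 / real h) * sqrt ((\<rho>' * real n - 2 * real h - 1) * ((1 - \<rho>') * real n))"
        proof -
          have "(\<rho>' - (2 * real h + 1) / real n) * (1 - \<rho>') * (real n)\<^sup>2 =
              (\<rho>' * real n - 2 * real h - 1) * ((1 - \<rho>') * real n)"
            using n by (simp add: field_simps power2_eq_square)
          then show ?thesis unfolding real_sqrt_mult[symmetric] by simp
        qed
        also have "\<dots> \<le> \<mu>"
          unfolding \<mu>_def using c1 c2 h(2) n \<rho>
          by (intro mult_left_mono real_sqrt_le_mono mult_mono) (auto simp: algebra_simps divide_le_eq)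
        finally have \<mu>: "(\<nu> + \<eta>) * real n \<le> \<mu>" .
        let ?B = "syn CC ` {A. A \<subseteq> {..<n} \<and> card A \<le> c + h}"
        have \<mu>2: "\<eta> * real n \<le> \<mu> - (real n - 2 * (\<delta> * real n))"
          using \<mu> by (simp add: \<nu>_def algebra_simps)
        have "0 < \<eta> * real n" using \<eta> n by simp
        have "\<eta> * real n * real (card CC) \<le> (\<mu> - (real n - 2 * (\<delta> * real n))) * real (card CC)"
          using \<mu>2 by (intro mult_right_mono) auto
        also have "\<dots> \<le> 2 * (\<delta> * real n) * real (card ?B)"
          using CC \<delta> \<mu>2 \<open>0 < \<eta> * real n\<close>
          by (intro set_code_card_le_ball[OF _ _ _ _ _ h(2) hc \<mu>_def]) auto
        finally have 1: "real (card CC) \<le> 2 * \<delta> / \<eta> * real (card ?B)"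
          using n \<eta> by (simp add: field_simps)
        have "x powr (\<rho>' * real n) \<le> x powr (real (c + h))"
          using x c1 by (intro powr_mono') auto
        also have "\<dots> = x ^ (c + h)" using x by (intro powr_realpow)
        finally have "x powr (\<rho>' * real n) * real (card ?B) \<le> x ^ (c + h) * real (card ?B)"
          by (intro mult_right_mono) auto
        also have "\<dots> \<le> b ^ card {..<n}"
          using CC by (intro card_syn_ball_le[OF _ _ x gf]) auto
        finally have "real (card ?B) \<le> x powr (- \<rho>' * real n) * b ^ n"
          using x by (simp add: powr_minus field_simps)
        then have "2 * \<delta> / \<eta> * real (card ?B) \<le> 2 * \<delta> / \<eta> * (x powr (- \<rho>' * real n) * b ^ n)"
          using \<delta> \<eta> by (intro mult_left_mono) auto
        with 1 show "real (card CC) \<le> 2 * \<delta> / \<eta> * x powr (- \<rho>' * real n) * b ^ n" by simp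
      qed
    qed
  qed
qed

subsection \<open>From codes to families of sets\<close>

definition supp :: "bool list \<Rightarrow> nat set" where
  "supp c = {i. i < length c \<and> c ! i}"

lemma card_supp: "card (supp c) = hweight c"
  by (simp add: supp_def hweight_def length_filter_conv_card)

lemma supp_subset: "c \<in> vecs n \<Longrightarrow> supp c \<subseteq> {..<n}"
  by (auto simp: supp_def vecs_def)

lemma supp_vadd: "c \<in> vecs n \<Longrightarrow> d \<in> vecs n \<Longrightarrow> supp (vadd c d) = sym_diff (supp c) (supp d)"
  by (auto simp: supp_def vecs_def vadd_def)

lemma orth_iff_even_supp:
  assumes "c \<in> vecs n" "d \<in> vecs n"
  shows "orth c d \<longleftrightarrow> even (card (supp c \<inter> supp d))"
proof -
  have "{i. i < length (map2 (\<and>) c d) \<and> id (map2 (\<and>) c d ! i)} = supp c \<inter> supp d"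
    using assms by (auto simp: supp_def vecs_def)
  then show ?thesis by (simp add: orth_def length_filter_conv_card)
qed

lemma inj_on_supp: "inj_on supp (vecs n)"
  by (intro inj_onI nth_equalityI) (auto simp: supp_def vecs_def set_eq_iff)

lemma supp_of_set: "y \<subseteq> {..<n} \<Longrightarrow> map (\<lambda>i. i \<in> y) [0..<n] \<in> vecs n \<and> supp (map (\<lambda>i. i \<in> y) [0..<n]) = y"
  by (auto simp: supp_def vecs_def)

lemma supp_zero [simp]: "supp (replicate n False) = {}"
  by (auto simp: supp_def)

lemma set_code_supp:
  assumes "linear_code n C"
  shows "set_code {..<n} (supp ` C)"
proof -
  have C: "\<And>c. c \<in> C \<Longrightarrow> c \<in> vecs n" "replicate n False \<in> C" "\<And>c d. c \<in> C \<Longrightarrow> d \<in> C \<Longrightarrow> vadd c d \<in> C"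
    using assms by (auto simp: linear_code_def)
  show ?thesis unfolding set_code_def
  proof (intro conjI ballI)
    show "supp ` C \<subseteq> Pow {..<n}" using C(1) supp_subset by auto
    show "{} \<in> supp ` C" using C(2) supp_zero by (metis image_eqI)
    fix c d assume "c \<in> supp ` C" "d \<in> supp ` C"
    then obtain c' d' where "c' \<in> C" "d' \<in> C" "c = supp c'" "d = supp d'" by auto
    then show "sym_diff c d \<in> supp ` C" using C supp_vadd by (metis image_eqI)
  qed
qed

lemma min_dist_supp:
  assumes "linear_code n C" "min_dist_ge d C" "A \<in> supp ` C" "A \<noteq> {}"
  shows "d \<le> real (card A)"
proof -
  obtain c where c: "c \<in> C" "A = supp c" using assms by auto
  have z: "replicate n False \<in> C" and vecs: "C \<subseteq> vecs n" using assms by (auto simp: linear_code_def)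
  have "c \<noteq> replicate n False" using c assms(4) by auto
  then have "d \<le> real (hdist c (replicate n False))"
    using assms(2) c z by (auto simp: min_dist_ge_def)
  also have "hdist c (replicate n False) = card A"
  proof -
    have "supp (vadd c (replicate n False)) = sym_diff (supp c) (supp (replicate n False))"
      using c z vecs by (intro supp_vadd) auto
    then show ?thesis by (simp add: hdist_def card_supp[symmetric] c)
  qed
  finally show ?thesis .
qed

text \<open>As \<open>1 < d\<close> excludes codewords of weight one, some dual word contains
  \<open>i\<close>. Words vanishing at \<open>i\<close> form a linear code, so if all light
  generators vanished there, the whole dual would.\<close>

lemma light_check_through_coordinate:
  assumes "linear_code n C" "pc_density_le n w C" "min_dist_ge d C" "1 < d" "i < n"
  shows "\<exists>s. i \<in> s \<and> s \<subseteq> {..<n} \<and> syn (supp ` C) s = {} \<and> card s \<le> w"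
proof -
  have vecs: "C \<subseteq> vecs n" using assms(1) by (auto simp: linear_code_def)
  have syn: "syn (supp ` C) (supp y) = {} \<longleftrightarrow> y \<in> dual_code n C" if "y \<in> vecs n" for y
  proof -
    have "orth c y \<longleftrightarrow> even (card (supp c \<inter> supp y))" if "c \<in> C" for c
      using that vecs \<open>y \<in> vecs n\<close> by (intro orth_iff_even_supp) auto
    then show ?thesis using that by (auto simp: syn_def dual_code_def)
  qed
  obtain S where S: "S \<subseteq> vecs n" "\<forall>s\<in>S. hweight s \<le> w" "dual_code n C = span2 n S"
    using assms(2) by (auto simp: pc_density_le_def)
  have "{i} \<notin> supp ` C"
    using min_dist_supp[OF assms(1,3), of "{i}"] assms(4) by auto
  then obtain y where y: "y \<subseteq> {..<n}" "syn (supp ` C) y = {}" "i \<in> y"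
    using dual_word_through_coordinate[OF _ set_code_supp[OF assms(1)], of i] assms(5) by auto
  define y' where "y' = map (\<lambda>i. i \<in> y) [0..<n]"
  have y': "y' \<in> vecs n" "supp y' = y" using supp_of_set[OF y(1)] by (auto simp: y'_def)
  then have "y' \<in> span2 n S" using syn y S(3) by auto
  have "\<exists>s\<in>S. s ! i"
  proof (rule ccontr)
    assume no: "\<not> (\<exists>s\<in>S. s ! i)"
    have "linear_code n {v \<in> vecs n. \<not> v ! i}"
      using assms(5) by (auto simp: linear_code_def vecs_def vadd_def)
    then have "span2 n S \<subseteq> {v \<in> vecs n. \<not> v ! i}" using S(1) no unfolding span2_def by blast
    then have "\<not> y' ! i" using \<open>y' \<in> span2 n S\<close> by auto
    then show False using y(3) assms(5) by (simp add: y'_def)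
  qed
  then obtain s where s: "s \<in> S" "s ! i" by auto
  have "s \<in> dual_code n C" unfolding S(3) span2_def using s by auto
  then have "syn (supp ` C) (supp s) = {}" using syn s S by auto
  moreover have "i \<in> supp s" using s S assms(5) by (auto simp: supp_def vecs_def)
  moreover have "card (supp s) \<le> w" using s S by (simp add: card_supp)
  ultimately show ?thesis using supp_subset s S by blast
qed

text \<open>After division by \<open>n\<close> the constant \<open>K\<close> disappears in the
  limit; this gives the bound for each \<open>\<rho>' > \<rho>\<close>, and then
  \<open>\<rho>'\<close> tends to \<open>\<rho>\<close>.\<close>

lemma R_rate_le:
  fixes \<delta> x b :: real
  assumes \<delta>: "0 < \<delta>" "\<delta> < 1/2"
    and x: "0 < x" "x \<le> 1" and gf: "growth_factor w x b" "0 < b"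
  shows "R_rate w \<delta> \<le> ereal (- (1/2 - sqrt (\<delta> * (1 - \<delta>))) * log 2 x + log 2 b)"
proof -
  define \<rho> where "\<rho> = 1/2 - sqrt (\<delta> * (1 - \<delta>))"
  have bound: "R_rate w \<delta> \<le> ereal (- \<rho>' * log 2 x + log 2 b)" if \<rho>': "\<rho> < \<rho>'" "\<rho>' < 1/2" for \<rho>'
  proof -
    obtain K where K: "0 < K" and ev: "eventually (\<lambda>n. \<forall>CC. set_code {..<n} CC \<longrightarrow>
      (\<forall>A\<in>CC. A \<noteq> {} \<longrightarrow> \<delta> * real n \<le> real (card A)) \<longrightarrow>
      (\<forall>i<n. \<exists>s. i \<in> s \<and> s \<subseteq> {..<n} \<and> syn CC s = {} \<and> card s \<le> w) \<longrightarrow>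
      real (card CC) \<le> K * x powr (- \<rho>' * real n) * b ^ n) sequentially"
      using eventually_set_code_card_le[OF \<delta> \<rho>_def \<rho>' x gf(1)] gf(2) by auto
    \<comment> \<open>This makes \<open>\<delta> * n\<close> exceed 1, so that light checks reach
      every coordinate.\<close>
    have ev2: "eventually (\<lambda>n. 1 / \<delta> < real n) sequentially"
      using filterlim_real_sequentially by (simp add: filterlim_at_top_dense)
    have "eventually (\<lambda>n. best_rate w \<delta> n \<le> ereal (log 2 K / real n + (- \<rho>' * log 2 x + log 2 b))) sequentially"
      using ev ev2
    proof eventually_elim
      case (elim n)
      have n: "1 < \<delta> * real n" using elim(2) \<delta> by (simp add: field_simps)
      then have n0: "0 < real n" using \<delta> by (cases n) auto
      show ?case unfolding best_rate_def
      proof (rule SUP_least, clarify)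
        fix C assume C: "linear_code n C" "pc_density_le n w C" "min_dist_ge (\<delta> * real n) C"
        have vecs: "C \<subseteq> vecs n" "C \<noteq> {}" using C(1) by (auto simp: linear_code_def)
        have card: "card (supp ` C) = card C"
          using inj_on_supp vecs by (intro card_image) (auto intro: inj_on_subset)
        have "finite (supp ` C)"
          using set_code_supp[OF C(1)] by (auto simp: set_code_def intro: finite_subset)
        then have cpos: "0 < real (card C)" using card vecs by (metis card_gt_0_iff image_is_empty of_nat_0_less_iff)
        have "real (card C) \<le> K * x powr (- \<rho>' * real n) * b ^ n"
          using elim(1)[rule_format, OF set_code_supp[OF C(1)]] min_dist_supp[OF C(1,3)]
            light_check_through_coordinate[OF C n] card by auto
        then have "log 2 (real (card C)) \<le> log 2 (K * x powr (- \<rho>' * real n) * b ^ n)"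
          using cpos by simp
        also have "\<dots> = log 2 K + (- \<rho>' * real n * log 2 x) + real n * log 2 b"
          using K x gf by (simp add: log_mult log_powr log_nat_power)
        finally have "log 2 (real (card C)) / real n \<le> (log 2 K + (- \<rho>' * real n * log 2 x) + real n * log 2 b) / real n"
          using n0 by (intro divide_right_mono) auto
        also have "\<dots> = log 2 K / real n + (- \<rho>' * log 2 x + log 2 b)"
          using n0 by (simp add: field_simps)
        finally show "ereal (log 2 (real (card C)) / real n) \<le> ereal (log 2 K / real n + (- \<rho>' * log 2 x + log 2 b))"
          by simp
      qed
    qed
    then have "R_rate w \<delta> \<le> limsup (\<lambda>n. ereal (log 2 K / real n + (- \<rho>' * log 2 x + log 2 b)))"
      unfolding R_rate_def by (rule Limsup_mono)
    also have "\<dots> = ereal (0 + (- \<rho>' * log 2 x + log 2 b))"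
      by (intro lim_imp_Limsup tendsto_intros lim_const_over_n) auto
    finally show ?thesis by simp
  qed
  have lt: "\<rho> < 1/2" using \<delta> by (simp add: \<rho>_def)
  have "((\<lambda>r. ereal (- r * log 2 x + log 2 b)) \<longlongrightarrow> ereal (- \<rho> * log 2 x + log 2 b)) (at_right \<rho>)"
    by (intro tendsto_intros) 
  moreover have "eventually (\<lambda>r. R_rate w \<delta> \<le> ereal (- r * log 2 x + log 2 b)) (at_right \<rho>)"
    using lt bound by (intro eventually_at_rightI[of _ "1/2"]) auto
  ultimately show ?thesis unfolding \<rho>_def
    by (rule tendsto_lowerbound) simp
qed

subsection \<open>Growth factors\<close>

text \<open>The substitution of \<open>t - k\<close> for \<open>k\<close> exchanges \<open>u\<close>
  and \<open>v\<close>, so \<open>v \<le> u\<close> may be assumed. Since \<open>x \<le> 1\<close>,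
  the comparison is weakest at the largest \<open>j\<close>, namely \<open>w - t\<close>.\<close>

lemma growth_factorI:
  assumes x: "0 \<le> x" "x \<le> 1"
    and le: "\<And>t u v. 1 \<le> t \<Longrightarrow> t \<le> w \<Longrightarrow> 0 \<le> v \<Longrightarrow> v \<le> u \<Longrightarrow> x ^ (w - t) * u \<le> v \<Longrightarrow>
      (\<Sum>k\<le>t. real (t choose k) * max (x ^ k * u) (x ^ (t - k) * v)) \<le> b ^ t * (u + v)"
  shows "growth_factor w x b"
  unfolding growth_factor_def
proof (intro allI impI)
  fix t j :: nat and u v :: real
  assume t: "1 \<le> t" "t + j \<le> w" and uv: "0 \<le> u" "0 \<le> v" "x ^ j * u \<le> v" "x ^ j * v \<le> u"
  have xj: "x ^ (w - t) \<le> x ^ j" using x t by (intro power_decreasing) auto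
  show "(\<Sum>k\<le>t. real (t choose k) * max (x ^ k * u) (x ^ (t - k) * v)) \<le> b ^ t * (u + v)"
  proof (cases "v \<le> u")
    case True
    have "x ^ (w - t) * u \<le> v" using mult_right_mono[OF xj uv(1)] uv by simp
    then show ?thesis using le[of t v u] True t uv by simp
  next
    case False
    have "x ^ (w - t) * v \<le> u" using mult_right_mono[OF xj uv(2)] uv by simp
    then have "(\<Sum>k\<le>t. real (t choose k) * max (x ^ k * v) (x ^ (t - k) * u)) \<le> b ^ t * (v + u)"
      using le[of t u v] False t uv by simp
    also have "(\<Sum>k\<le>t. real (t choose k) * max (x ^ k * v) (x ^ (t - k) * u))
        = (\<Sum>k\<le>t. real (t choose k) * max (x ^ k * u) (x ^ (t - k) * v))"
      by (rule sum.reindex_bij_witness[of _ "\<lambda>k. t - k" "\<lambda>k. t - k"])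
         (auto simp: max.commute binomial_symmetric[symmetric])
    finally show ?thesis by (simp add: add.commute)
  qed
qed

text \<open>The two entries of each maximum are within a factor \<open>x ^ w\<close> of each other,
  so the maximum is at most their sum divided by \<open>1 + x ^ w\<close>. The binomial theorem
  evaluates the sums.\<close>

lemma growth_factor_general:
  assumes x: "0 < x" "x \<le> 1" and w: "1 \<le> w"
  shows "growth_factor w x ((1 + x) * (1 + x ^ w) powr (- 1 / real w))"
proof (rule growth_factorI)
  fix t :: nat and u v :: real
  assume t: "1 \<le> t" "t \<le> w" and uv: "0 \<le> v" "v \<le> u" "x ^ (w - t) * u \<le> v"
  define D where "D = 1 + x ^ w"
  have D: "1 \<le> D" using x by (simp add: D_def)
  have max_le: "max (x ^ k * u) (x ^ (t - k) * v) * D \<le> x ^ k * u + x ^ (t - k) * v" if k: "k \<le> t" for k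
  proof -
    have "x ^ w * (x ^ k * u) \<le> x ^ (t - k + (w - t)) * u"
    proof -
      have "x ^ (w + k) \<le> x ^ (t - k + (w - t))" using x t k by (intro power_decreasing) auto
      from mult_right_mono[OF this, of u] show ?thesis using uv by (simp add: power_add mult.assoc)
    qed
    also have "\<dots> \<le> x ^ (t - k) * v" using uv x by (simp add: power_add mult.assoc)
    finally have 1: "x ^ w * (x ^ k * u) \<le> x ^ (t - k) * v" .
    have "x ^ (w + (t - k)) \<le> x ^ k" using x t k by (intro power_decreasing) auto
    then have "x ^ (w + (t - k)) * v \<le> x ^ k * u" using uv x by (intro mult_mono) auto
    then have 2: "x ^ w * (x ^ (t - k) * v) \<le> x ^ k * u" by (simp add: power_add mult.assoc)
    show ?thesis using 1 2 by (auto simp: D_def max_def algebra_simps)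
  qed
  have "(\<Sum>k\<le>t. real (t choose k) * max (x ^ k * u) (x ^ (t - k) * v)) * D
      \<le> (\<Sum>k\<le>t. real (t choose k) * (x ^ k * u + x ^ (t - k) * v))"
    unfolding sum_distrib_right using max_le by (intro sum_mono) (auto simp: mult.assoc intro!: mult_left_mono)
  also have "\<dots> = (\<Sum>k\<le>t. real (t choose k) * x ^ k * 1 ^ (t - k)) * u + (\<Sum>k\<le>t. real (t choose k) * 1 ^ k * x ^ (t - k)) * v"
    unfolding sum_distrib_right sum.distrib[symmetric] by (intro sum.cong) (auto simp: algebra_simps)
  also have "\<dots> = (1 + x) ^ t * (u + v)"
    unfolding binomial_ring[symmetric] by (simp add: algebra_simps)
  finally have "(\<Sum>k\<le>t. real (t choose k) * max (x ^ k * u) (x ^ (t - k) * v)) \<le> (1 + x) ^ t * D powr (- 1) * (u + v)"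
    using D by (simp add: powr_minus field_simps)
  \<comment> \<open>The saving per check becomes a saving per new coordinate, with equality at
    \<open>t = w\<close>.\<close>
  also have "\<dots> \<le> (1 + x) ^ t * D powr (- real t / real w) * (u + v)"
    using D t uv x w by (intro mult_right_mono mult_left_mono powr_mono) (auto simp: field_simps)
  also have "D powr (- real t / real w) = (D powr (- 1 / real w)) ^ t"
    using D by (simp add: powr_realpow[symmetric] powr_powr)
  finally show "(\<Sum>k\<le>t. real (t choose k) * max (x ^ k * u) (x ^ (t - k) * v))
      \<le> ((1 + x) * (1 + x ^ w) powr (- 1 / real w)) ^ t * (u + v)"
    by (simp add: power_mult_distrib D_def)
qed (use x in auto)

section \<open>Sharper factors for check weights 3 and 4\<close>

text \<open>The case \<open>t = 1\<close>, with \<open>y = x ^ (w - 1)\<close>. If \<open>v\<close>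
  attains the maximum, \<open>b \<ge> 1\<close> suffices; otherwise \<open>v = y * u\<close> is the
  worst case.\<close>

lemma growth_bound_one:
  fixes u v x y b :: real
  assumes "1 \<le> b" "1 + x \<le> b * (1 + y)" "y * u \<le> v" "0 \<le> v" "v \<le> u"
  shows "u + max (x * u) v \<le> b * (u + v)"
proof (cases "x * u \<le> v")
  case True
  then show ?thesis using mult_right_mono[OF assms(1), of "u + v"] assms by (simp add: max_def)
next
  case False
  have "(1 + x) * u \<le> b * (1 + y) * u" using assms by (intro mult_right_mono) auto
  also have "\<dots> \<le> b * (u + v)" using assms by (simp add: mult.assoc algebra_simps mult_left_mono)
  finally show ?thesis using False by (simp add: max_def algebra_simps)
qed

text \<open>The case \<open>t = 2\<close>, with \<open>y = x ^ (w - 2)\<close>. Both sides are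
  linear in \<open>v\<close>, and \<open>b \<ge> 1\<close> makes \<open>v = y * u\<close> the worst
  case.\<close>

lemma growth_bound_two:
  fixes u v x y b :: real
  assumes "1 \<le> b" "1 + 2 * x + y \<le> b * (1 + y)" "y * u \<le> v" "0 \<le> u"
  shows "u + 2 * x * u + v \<le> b * (u + v)"
proof -
  have "(1 + 2 * x + y) * u \<le> b * (1 + y) * u" using assms by (intro mult_right_mono) auto
  moreover have "(b - 1) * (y * u) \<le> (b - 1) * v" using assms by (intro mult_left_mono) auto
  ultimately show ?thesis by (simp add: algebra_simps)
qed

text \<open>For \<open>t = 3\<close> the check has no old coordinates, so \<open>u = v\<close> and
  equality holds; this determines \<open>b\<close>. The smaller \<open>t\<close> reduce to
  polynomial inequalities.\<close>

lemma growth_factor_3: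
  assumes x: "0 < x" "x \<le> 1" and b: "0 < b" "b ^ 3 = 1 + 3 * x"
  shows "growth_factor 3 x b"
proof (rule growth_factorI)
  fix t :: nat and u v :: real
  assume t: "1 \<le> t" "t \<le> 3" and uv: "0 \<le> v" "v \<le> u" "x ^ (3 - t) * u \<le> v"
  have b1: "1 \<le> b"
    by (rule power_le_imp_le_base[of _ 2]) (use b x in \<open>auto simp: eval_nat_numeral\<close>)
  have xv: "x * v \<le> u" using mult_mono[of x 1 v u] x uv by simp
  have xvu: "x * v \<le> x * u" using x uv by simp
  consider "t = 1" | "t = 2" | "t = 3" using t by linarith
  then show "(\<Sum>k\<le>t. real (t choose k) * max (x ^ k * u) (x ^ (t - k) * v)) \<le> b ^ t * (u + v)"
  proof cases
    case 1
    have "1 + x \<le> b * (1 + x\<^sup>2)"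
    \<comment> \<open>Only \<open>b ^ 3\<close> is explicit, so cubes are compared; the rule takes
      the exponent as \<open>Suc 2\<close>.\<close>
    proof (rule power_le_imp_le_base[of _ 2])
      have "(1 + x) ^ 3 \<le> (1 + 3 * x) * (1 + x\<^sup>2) ^ 3"
      proof -
        have "(1 + 3 * x) * (1 + x\<^sup>2) ^ 3 - (1 + x) ^ 3 = 8*x^3 + 3*x^4 + 9*x^5 + x^6 + 3*x^7"
          by (simp add: eval_nat_numeral algebra_simps)
        moreover have "0 \<le> 8*x^3 + 3*x^4 + 9*x^5 + x^6 + 3*x^7" using x by simp
        ultimately show ?thesis by linarith
      qed
      then show "(1 + x) ^ Suc 2 \<le> (b * (1 + x\<^sup>2)) ^ Suc 2"
        using b by (simp add: power_mult_distrib flip: numeral_3_eq_3)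
    qed (use b in auto)
    then have "u + max (x * u) v \<le> b * (u + v)"
      using growth_bound_one[OF b1, of x "x\<^sup>2" u v] uv 1 by simp
    moreover have "(\<Sum>k\<le>t. real (t choose k) * max (x ^ k * u) (x ^ (t - k) * v)) = u + max (x * u) v"
      using 1 xv by simp
    ultimately show ?thesis using 1 by simp
  next
    case 2
    have "1 + 2 * x + x \<le> b\<^sup>2 * (1 + x)"
    proof (rule power_le_imp_le_base[of _ 2])
      \<comment> \<open>This rests on \<open>1 + 3 * x \<le> (1 + x) ^ 3\<close>.\<close>
      have "(1 + 3 * x) ^ 2 * (1 + 3 * x) \<le> (1 + 3 * x) ^ 2 * (1 + x) ^ 3"
        using x by (intro mult_left_mono) (auto simp: eval_nat_numeral algebra_simps)
      also have "\<dots> = (b\<^sup>2 * (1 + x)) ^ 3"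
        unfolding power_mult_distrib b(2)[symmetric] by (simp flip: power_mult)
      finally show "(1 + 2 * x + x) ^ Suc 2 \<le> (b\<^sup>2 * (1 + x)) ^ Suc 2"
        by (simp add: eval_nat_numeral algebra_simps)
    qed (use b x in auto)
    moreover have "1 \<le> b\<^sup>2" using b1 by simp
    ultimately have "u + 2 * x * u + v \<le> b\<^sup>2 * (u + v)"
      using growth_bound_two[of "b\<^sup>2" x x u v] uv 2 by simp
    moreover have "(\<Sum>k\<le>t. real (t choose k) * max (x ^ k * u) (x ^ (t - k) * v)) = u + 2 * x * u + v"
    proof -
      have "max u (x\<^sup>2 * v) = u" using mult_mono[of "x\<^sup>2" 1 v u] x uv by (simp add: power_le_one max_def)
      moreover have "max (x\<^sup>2 * u) v = v"
        using mult_right_mono[of "x\<^sup>2" x u] power_decreasing[of 1 2 x] x uv 2 by simp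
      ultimately show ?thesis using 2 xvu by (simp add: numeral_2_eq_2 max_absorb1)
    qed
    ultimately show ?thesis using 2 by simp
  next
    case 3
    then have v: "v = u" using uv by simp
    have p: "x ^ 2 \<le> x" "x ^ 3 \<le> 1" using power_decreasing[of 1 2 x] x by (auto simp: power_le_one)
    have m: "max (x ^ 2 * u) (x * u) = x * u" "max (x * u) (x ^ 2 * u) = x * u"
       "max u (x ^ 3 * u) = u" "max (x ^ 3 * u) u = u"
      using mult_right_mono[OF p(1), of u] mult_right_mono[OF p(2), of u] uv by auto
    have "(\<Sum>k\<le>t. real (t choose k) * max (x ^ k * u) (x ^ (t - k) * v)) = (1 + 3 * x) * (u + v)"
      using m unfolding 3 v by (simp add: eval_nat_numeral algebra_simps)
    then show ?thesis using b 3 by simp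
  qed
qed (use x in auto)

text \<open>\<open>b ^ 4\<close> agrees with \<open>(1 + x) ^ 4\<close> up to second order, as the
  case \<open>t = 1\<close> demands for small \<open>x\<close>. The case \<open>t = 4\<close> has
  room to spare.\<close>

lemma growth_factor_4:
  assumes x: "0 < x" "x \<le> 1" and b: "0 < b" "b ^ 4 = 1 + 4 * x + 6 * x\<^sup>2"
  shows "growth_factor 4 x b"
proof (rule growth_factorI)
  fix t :: nat and u v :: real
  assume t: "1 \<le> t" "t \<le> 4" and uv: "0 \<le> v" "v \<le> u" "x ^ (4 - t) * u \<le> v"
  have b1: "1 \<le> b"
    by (rule power_le_imp_le_base[of _ 3]) (use b x in \<open>auto simp: eval_nat_numeral\<close>)
  have p: "x ^ 2 \<le> x" "x ^ 3 \<le> x" "x ^ 3 \<le> x ^ 2" "x ^ 2 \<le> 1" "x ^ 3 \<le> 1" "x ^ 4 \<le> 1"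
    using power_decreasing[of 1 2 x] power_decreasing[of 1 3 x] power_decreasing[of 2 3 x] x
    by (auto simp: power_le_one)
  have pu: "c * u \<le> d * u" "c * v \<le> d * v" "c * v \<le> d * u" if "c \<le> d" "0 \<le> d" for c d
    using that uv mult_mono[of c d v u] by (auto intro!: mult_right_mono)
  consider "t = 1" | "t = 2" | "t = 3" | "t = 4" using t by linarith
  then show "(\<Sum>k\<le>t. real (t choose k) * max (x ^ k * u) (x ^ (t - k) * v)) \<le> b ^ t * (u + v)"
  proof cases
    case 1
    have "1 + x \<le> b * (1 + x ^ 3)"
    proof (rule power_le_imp_le_base[of _ 3])
      have "(1 + x) ^ 4 \<le> (1 + 4 * x + 6 * x\<^sup>2) * (1 + 4 * x ^ 3)"
      proof -
        have "(1 + 4 * x + 6 * x\<^sup>2) * (1 + 4 * x ^ 3) - (1 + x) ^ 4 = 15 * x^4 + 24 * x^5"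
          by (simp add: eval_nat_numeral algebra_simps)
        moreover have "0 \<le> 15 * x^4 + 24 * x^5" using x by simp
        ultimately show ?thesis by linarith
      qed
      also have "\<dots> \<le> b ^ 4 * (1 + x ^ 3) ^ 4"
      proof -
        have "- 1 \<le> x ^ 3" using zero_le_power[of x 3] x by linarith
        from Bernoulli_inequality[OF this, of 4] show ?thesis
          unfolding b(2) using x by (intro mult_left_mono) auto
      qed
      finally show "(1 + x) ^ Suc 3 \<le> (b * (1 + x ^ 3)) ^ Suc 3"
        by (simp add: power_mult_distrib)
    qed (use b x in auto)
    then have "u + max (x * u) v \<le> b * (u + v)"
      using growth_bound_one[OF b1, of x "x ^ 3" u v] uv 1 by simp
    moreover have "(\<Sum>k\<le>t. real (t choose k) * max (x ^ k * u) (x ^ (t - k) * v)) = u + max (x * u) v"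
      using 1 pu(3)[of x 1] x by simp
    ultimately show ?thesis using 1 by simp
  next
    case 2
    have "1 + 2 * x + x\<^sup>2 \<le> b\<^sup>2 * (1 + x\<^sup>2)"
    proof (rule power_le_imp_le_base[of _ 1])
      have "(1 + 4 * x + 6 * x\<^sup>2) * (1 + x\<^sup>2)\<^sup>2 - (1 + 2 * x + x\<^sup>2)\<^sup>2 =
          2 * x^2 + 4 * x^3 + 12 * x^4 + 4 * x^5 + 6 * x^6"
        by (simp add: eval_nat_numeral algebra_simps)
      moreover have "0 \<le> 2 * x^2 + 4 * x^3 + 12 * x^4 + 4 * x^5 + 6 * x^6" using x by simp
      ultimately have "(1 + 2 * x + x\<^sup>2)\<^sup>2 \<le> b ^ 4 * (1 + x\<^sup>2)\<^sup>2" unfolding b(2) by linarith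
      then show "(1 + 2 * x + x\<^sup>2) ^ Suc 1 \<le> (b\<^sup>2 * (1 + x\<^sup>2)) ^ Suc 1"
        by (simp add: power_mult_distrib flip: numeral_2_eq_2 power_mult)
    qed (use b x in auto)
    moreover have "1 \<le> b\<^sup>2" using b1 by simp
    ultimately have "u + 2 * x * u + v \<le> b\<^sup>2 * (u + v)"
      using growth_bound_two[of "b\<^sup>2" x "x\<^sup>2" u v] uv 2 by simp
    moreover have "(\<Sum>k\<le>t. real (t choose k) * max (x ^ k * u) (x ^ (t - k) * v)) = u + 2 * x * u + v"
    proof -
      have "max u (x\<^sup>2 * v) = u" "max (x * u) (x * v) = x * u" "max (x\<^sup>2 * u) v = v"
        using pu(3)[of "x\<^sup>2" 1] pu(3)[of x x] x p uv 2 by auto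
      then show ?thesis using 2 by (simp add: numeral_2_eq_2)
    qed
    ultimately show ?thesis using 2 by simp
  next
    case 3
    then have xu: "x * u \<le> v" using uv by simp
    \<comment> \<open>The constraint \<open>x * u \<le> v\<close> decides the terms
      \<open>k = 2\<close> and \<open>k = 3\<close> in favour of \<open>v\<close>.\<close>
    have m: "max u (x ^ 3 * v) = u" "max (x * u) (x\<^sup>2 * v) = x * u" "max (x\<^sup>2 * u) (x * v) = x * v"
      "max (x ^ 3 * u) v = v"
      using pu(3)[of "x ^ 3" 1] pu(3)[of "x\<^sup>2" x] mult_left_mono[OF xu, of x] pu(1)[of "x ^ 3" x] xu x p
      by (auto simp: power2_eq_square mult.assoc)
    have "1 + 3 * x \<le> b ^ 3"
    proof (rule power_le_imp_le_base[of _ 3])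
      have "(1 + 4 * x + 6 * x\<^sup>2) ^ 3 - (1 + 3 * x) ^ 4 = 12 * x^2 + 100 * x^3 + 315 * x^4 + 432 * x^5 + 216 * x^6"
        by (simp add: eval_nat_numeral algebra_simps)
      moreover have "0 \<le> 12 * x^2 + 100 * x^3 + 315 * x^4 + 432 * x^5 + 216 * x^6" using x by simp
      ultimately have "(1 + 3 * x) ^ 4 \<le> (b ^ 4) ^ 3" unfolding b(2) by linarith
      then show "(1 + 3 * x) ^ Suc 3 \<le> (b ^ 3) ^ Suc 3" by (simp flip: power_mult)
    qed (use b in auto)
    then have "(1 + 3 * x) * (u + v) \<le> b ^ 3 * (u + v)" using uv by (intro mult_right_mono) auto
    moreover have "(\<Sum>k\<le>t. real (t choose k) * max (x ^ k * u) (x ^ (t - k) * v)) = (1 + 3 * x) * (u + v)"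
      using m unfolding 3 by (simp add: eval_nat_numeral algebra_simps)
    ultimately show ?thesis using 3 by simp
  next
    case 4
    then have v: "v = u" using uv by simp
    have m: "max u (x ^ 4 * u) = u" "max (x * u) (x ^ 3 * u) = x * u" "max (x ^ 3 * u) (x * u) = x * u"
      "max (x ^ 4 * u) u = u"
      using pu(1)[of "x ^ 4" 1] pu(1)[of "x ^ 3" x] x p by auto
    have "(\<Sum>k\<le>t. real (t choose k) * max (x ^ k * u) (x ^ (t - k) * v)) = (2 + 8 * x + 6 * x\<^sup>2) * u"
      using m unfolding 4 v by (simp add: eval_nat_numeral algebra_simps)
    also have "\<dots> \<le> (2 * (1 + 4 * x + 6 * x\<^sup>2)) * u" using uv by (intro mult_right_mono) auto
    also have "\<dots> = b ^ t * (u + v)" unfolding 4 v b(2) by (simp add: algebra_simps)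
    finally show ?thesis .
  qed
qed (use x in auto)

subsection \<open>The rate bounds\<close>

lemma power_powr_inverse:
  fixes y :: real
  assumes "0 < y" "0 < k"
  shows "(y powr (1 / real k)) ^ k = y"
  using assms by (simp add: powr_realpow[symmetric] powr_powr)

text \<open>The minimum of \<open>- r * log 2 x + log 2 (1 + x)\<close> over positive
  \<open>x\<close>, attained at \<open>x = r / (1 - r)\<close>.\<close>

lemma bin_entropy_odds:
  assumes "0 < r" "r < 1"
  shows "- r * log 2 (r / (1 - r)) - log 2 (1 - r) = bin_entropy r"
  using assms by (simp add: bin_entropy_def log_divide algebra_simps)

theorem theorem4:
  fixes \<delta> \<rho> :: real
  assumes "0 < \<delta>" and "\<delta> < 1/2"
  defines "\<rho> \<equiv> 1/2 - sqrt (\<delta> * (1 - \<delta>))"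
  shows "(\<forall>w::nat. w \<ge> 3 \<longrightarrow>
            R_rate w \<delta> \<le> ereal (bin_entropy \<rho> - (1 / real w) * log 2 (1 + (\<rho> / (1 - \<rho>)) ^ w)))
       \<and> R_rate 3 \<delta> \<le> ereal (if \<delta> \<le> 1/2 - sqrt 3 / 4 then 2/3 else 2/3 * H4 (3 * \<rho>))
       \<and> R_rate 4 \<delta> \<le> ereal (bin_entropy \<rho> + 1/4 * log 2 (Fpoly \<rho>))"
proof -
  have "0 < (1/2 - \<delta>)\<^sup>2" using assms by simp
  then have "\<delta> * (1 - \<delta>) < (1/2)\<^sup>2" by (simp add: power2_eq_square algebra_simps)
  then have "sqrt (\<delta> * (1 - \<delta>)) < 1/2" by (intro real_less_lsqrt) auto
  moreover have "0 < sqrt (\<delta> * (1 - \<delta>))" using assms by simp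
  ultimately have \<rho>: "0 < \<rho>" "\<rho> < 1/2" by (auto simp: \<rho>_def)
  define x where "x = \<rho> / (1 - \<rho>)"
  have x: "0 < x" "x \<le> 1" using \<rho> by (auto simp: x_def)
  have x1: "1 + x = 1 / (1 - \<rho>)" using \<rho> by (simp add: x_def field_simps)
  have H: "- \<rho> * log 2 x - log 2 (1 - \<rho>) = bin_entropy \<rho>"
    unfolding x_def using \<rho> by (intro bin_entropy_odds) auto
  have 1: "R_rate w \<delta> \<le> ereal (bin_entropy \<rho> - (1 / real w) * log 2 (1 + (\<rho> / (1 - \<rho>)) ^ w))"
    if w: "w \<ge> 3" for w
  proof -
    have "0 < 1 + x ^ w" using x by (simp add: add_pos_pos)
    then have "log 2 ((1 + x) * (1 + x ^ w) powr (- 1 / real w)) = log 2 (1 + x) - (1 / real w) * log 2 (1 + x ^ w)"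
      using x by (simp add: log_mult log_powr)
    also have "log 2 (1 + x) = - log 2 (1 - \<rho>)" unfolding x1 using \<rho> by (simp add: log_divide)
    finally have "- \<rho> * log 2 x + log 2 ((1 + x) * (1 + x ^ w) powr (- 1 / real w)) =
        bin_entropy \<rho> - (1 / real w) * log 2 (1 + x ^ w)" using H by simp
    moreover have "growth_factor w x ((1 + x) * (1 + x ^ w) powr (- 1 / real w))"
      using x w by (intro growth_factor_general) auto
    moreover have "0 < (1 + x) * (1 + x ^ w) powr (- 1 / real w)"
      using x \<open>0 < 1 + x ^ w\<close> by simp
    ultimately show ?thesis using R_rate_le[OF assms(1,2) x] unfolding \<rho>_def[symmetric] by (metis x_def)
  qed
  \<comment> \<open>\<open>z\<close> stays free, because the best choice depends on whether
    \<open>\<rho>\<close> lies below 1/4.\<close>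
  have three: "R_rate 3 \<delta> \<le> ereal (- \<rho> * log 2 z + 1/3 * log 2 (1 + 3 * z))" if z: "0 < z" "z \<le> 1" for z
  proof -
    have "growth_factor 3 z ((1 + 3 * z) powr (1/3))"
      using z power_powr_inverse[of "1 + 3 * z" 3] by (intro growth_factor_3) auto
    from R_rate_le[OF assms(1,2) z this] show ?thesis
      using z by (simp add: \<rho>_def log_powr)
  qed
  have 2: "R_rate 3 \<delta> \<le> ereal (if \<delta> \<le> 1/2 - sqrt 3 / 4 then 2/3 else 2/3 * H4 (3 * \<rho>))"
  proof (cases "\<delta> \<le> 1/2 - sqrt 3 / 4")
    case True
    \<comment> \<open>At \<open>z = 1\<close> the bound is a third of
      \<open>log 2 4\<close>.\<close>
    have "log 2 (4::real) = 2" using log_nat_power[of 2 2 2] by simp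
    then show ?thesis using three[of 1] True by simp
  next
    case False
    have "(1/2 - \<delta>)\<^sup>2 < (sqrt 3 / 4)\<^sup>2" using False assms by (intro power_strict_mono) auto
    then have "(1/4)\<^sup>2 < \<delta> * (1 - \<delta>)" by (simp add: power2_eq_square algebra_simps)
    then have "1/4 < sqrt (\<delta> * (1 - \<delta>))" by (rule real_less_rsqrt)
    then have \<rho>4: "\<rho> < 1/4" by (simp add: \<rho>_def)
    \<comment> \<open>The minimiser of the bound \<open>three\<close>; it is at most 1 because
      \<open>\<rho> < 1/4\<close>.\<close>
    define z where "z = \<rho> / (1 - 3 * \<rho>)"
    have z: "0 < z" "z \<le> 1" using \<rho> \<rho>4 by (auto simp: z_def)
    have z1: "1 + 3 * z = 1 / (1 - 3 * \<rho>)" using \<rho>4 by (simp add: z_def field_simps)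
    have log4: "log 4 y = log 2 y / 2" for y :: real
    proof -
      have "ln (4::real) = 2 * ln 2" using ln_realpow[of 2 2] by simp
      then show ?thesis by (simp add: log_def)
    qed
    have eq: "- \<rho> * log 2 z + 1/3 * log 2 (1 + 3 * z) = 2/3 * H4 (3 * \<rho>)"
    proof -
      have logs: "log 2 z = log 2 \<rho> - log 2 (1 - 3 * \<rho>)" "log 2 (1 + 3 * z) = - log 2 (1 - 3 * \<rho>)"
        "log 2 (3 * \<rho>) = log 2 3 + log 2 \<rho>"
        unfolding z1 unfolding z_def using \<rho> \<rho>4 by (auto simp: log_divide log_mult)
      show ?thesis unfolding H4_def log4 logs by (simp add: field_simps)
    qed
    show ?thesis using three[OF z, unfolded eq] False by simp
  qed
  have 3: "R_rate 4 \<delta> \<le> ereal (bin_entropy \<rho> + 1/4 * log 2 (Fpoly \<rho>))"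
  proof -
    \<comment> \<open>\<open>f\<close> is \<open>b ^ 4\<close> at the same \<open>x\<close> as in
      the general bound, which turns it into \<open>Fpoly \<rho>\<close> up to the factor
      \<open>(1 - \<rho>) ^ 4\<close>.\<close>
    define f where "f = 1 + 4 * x + 6 * x\<^sup>2"
    have f: "0 < f" using x by (simp add: f_def add_pos_pos)
    have F: "Fpoly \<rho> = (1 - \<rho>) ^ 4 * f"
    proof -
      have "y ^ 4 + 4 * r * y ^ 3 + 6 * r\<^sup>2 * y\<^sup>2 = y ^ 4 * f" if "y * x = r" for y r
        unfolding that[symmetric] f_def by (simp add: eval_nat_numeral algebra_simps)
      moreover have "(1 - \<rho>) * x = \<rho>" using \<rho> by (simp add: x_def)
      ultimately show ?thesis unfolding Fpoly_def by blast
    qed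
    have "log 2 (Fpoly \<rho>) = 4 * log 2 (1 - \<rho>) + log 2 f"
      unfolding F using f \<rho> by (simp add: log_mult log_nat_power)
    then have eq: "- \<rho> * log 2 x + 1/4 * log 2 f = bin_entropy \<rho> + 1/4 * log 2 (Fpoly \<rho>)"
      unfolding H[symmetric] by argo
    have "growth_factor 4 x (f powr (1/4))"
      using x f power_powr_inverse[of f 4] by (intro growth_factor_4) (auto simp: f_def)
    from R_rate_le[OF assms(1,2) x this] show ?thesis
      using f eq by (simp add: \<rho>_def log_powr)
  qed
  from 1 2 3 show ?thesis by blast
qed

end
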